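(* Given real $\alpha>0$, $\delta\in(0,\alpha)$, $\kappa>\frac12$, and an integer $m\geq 1$, there exist an increasing sequence $\{\lambda_n\}_{n\geq1}$ of real numbers tending to infinity with $\lambda_1\geq 1$, and a sequence of non-negative real numbers $\{a_n\}_{n\geq 1}$, defining a general Dirichlet series $A(s)=\sum_{n=1}^\infty a_n\lambda_n^{-s}$ which satisfies all of the following: (i) The Dirichlet series $A(s)$ satisfies Hypothesis B with $\alpha,\delta,\kappa$ and $m$. (ii* ) For all $n\geq 1$, $0\leq a_n\leq 1$. (iii) As $x\to\infty$, $\displaystyle\sum_{\lambda_n\leq x}a_n=\operatorname{Res}_{s=\alpha}\Big[A(s)\frac{x^s}{s}\Big]+\Omega\Big(x^{\alpha-\frac{\delta}{\kappa+1/2}}(\log x)^{m-1}\Big)$.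
   Context: The notation $f(x)=\Omega(g(x))$ means $\limsup_{x\to\infty}|f(x)/g(x)|>0$; (iii) means that the difference between the partial sum and the residue is $\Omega(\cdot)$ of the displayed function. Hypothesis B (for real $\alpha>0$, $\delta\in(0,\alpha)$, $\kappa\geq 0$ and integer $m\ge1$): The general Dirichlet series $A(s)=\sum_n a_n\lambda_n^{-s}$ with non-negative coefficients (well-defined for $s$ in an appropriate right half-plane) can be analytically continued to the region $\Re(s)\geq\alpha-\delta$ aside from a pole of order $m$ at the real point $s=\alpha$. Moreover, for some $M_1,M_2\geq 0$, $$|(s-\alpha)^mA(s)|\leq M_1\exp(|s|^{M_2})\quad\text{for all } s \text{ in the strip } \alpha-\delta\leq\Re(s)\leq\alpha,$$ and there exists $C\geq 1$ such that for $\Re(s)=\alpha-\delta$, $$|A(s)|\leq C(1+|\Im(s)|)^{\kappa}(\log(3+|\Im(s)|))^{m-1}.$$ *)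

theory Defs
  imports "HOL-Complex_Analysis.Complex_Analysis"
begin

text \<open>
  Sequences are indexed by \<open>n \<ge> 1\<close>; the values at index \<open>0\<close> are never used.
\<close>

definition general_dirichlet_partial_sum :: "(nat \<Rightarrow> real) \<Rightarrow> (nat \<Rightarrow> real) \<Rightarrow> real \<Rightarrow> real" where
  "general_dirichlet_partial_sum a l x = (\<Sum>n | 1 \<le> n \<and> l n \<le> x. a n)"

text \<open>
  \<open>A\<close> is a meromorphic continuation of the series: it agrees with the sum of the series on
  some half-plane \<open>Re s > c\<close> where the series converges.  On the region of continuation it is
  unique by the identity theorem; its value at the pole itself is irrelevant, also for
  \<^const>\<open>residue\<close>.  Since \<open>analytic_on\<close> demands holomorphy on an open neighbourhood
  of each point, the line \<open>Re s = \<alpha> - \<delta>\<close> is included in the continuation.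
  In the strip bound the point \<open>s = \<alpha>\<close> imposes no condition on \<open>A \<alpha>\<close>, because
  \<open>m \<ge> 1\<close>; the bound for the removable value there follows by continuity.
\<close>

definition hypothesis_B ::
  "(nat \<Rightarrow> real) \<Rightarrow> (nat \<Rightarrow> real) \<Rightarrow> (complex \<Rightarrow> complex) \<Rightarrow> real \<Rightarrow> real \<Rightarrow> real \<Rightarrow> nat \<Rightarrow> bool" where
  "hypothesis_B a l A \<alpha> \<delta> \<kappa> m \<longleftrightarrow>
     0 < \<alpha> \<and> 0 < \<delta> \<and> \<delta> < \<alpha> \<and> 0 \<le> \<kappa> \<and> 1 \<le> m \<and>
     (\<forall>n\<ge>1. 0 \<le> a n) \<and>
     (\<exists>c::real. \<forall>s. Re s > c \<longrightarrow>
        (\<lambda>n. of_real (a (Suc n)) * of_real (l (Suc n)) powr (- s)) sums A s) \<and>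
     A analytic_on ({s. Re s \<ge> \<alpha> - \<delta>} - {of_real \<alpha>}) \<and>
     is_pole A (of_real \<alpha>) \<and> zorder A (of_real \<alpha>) = - int m \<and>
     (\<exists>M1 M2 :: real. M1 \<ge> 0 \<and> M2 \<ge> 0 \<and>
        (\<forall>s. \<alpha> - \<delta> \<le> Re s \<and> Re s \<le> \<alpha> \<longrightarrow>
           cmod ((s - of_real \<alpha>) ^ m * A s) \<le> M1 * exp (cmod s powr M2))) \<and>
     (\<exists>C::real. C \<ge> 1 \<and>
        (\<forall>s. Re s = \<alpha> - \<delta> \<longrightarrow>
           cmod (A s) \<le> C * (1 + \<bar>Im s\<bar>) powr \<kappa> * ln (3 + \<bar>Im s\<bar>) ^ (m - 1)))"

text \<open>
  The Omega of Hardy and Littlewood, i.e. the negation of \<open>f = o(g)\<close>; it is weaker than the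
  lower-bound symbol \<^const>\<open>bigomega\<close> of the library.
\<close>

definition hl_omega :: "(real \<Rightarrow> complex) \<Rightarrow> (real \<Rightarrow> real) \<Rightarrow> bool" where
  "hl_omega f g \<longleftrightarrow> Limsup at_top (\<lambda>x. ereal (cmod (f x / of_real (g x)))) > 0"

end

theory Submission
  imports Defs "HOL-Library.Discrete_Functions" "HOL-Real_Asymp.Real_Asymp"
begin

text \<open>
  Put \<open>\<lambda>\<^sub>n = n powr t\<close> with \<open>t = 1 / (8 \<alpha>)\<close> and \<open>z = 1 + t (s - \<alpha>)\<close>, so that the line
  \<open>Re s = \<alpha> - \<delta>\<close> lies just to the left of \<open>Re z = 1\<close>.  The coefficients \<open>(ln n) ^ (m - 1)\<close> give, up to sign,
  the derivative of order \<open>m - 1\<close> of the zeta function at \<open>z\<close>, which is \<open>O(\<bar>z\<bar> powr (1/2))\<close> there; this is where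
  \<open>\<kappa> > 1/2\<close> enters.  To it is added an oscillation of comparable amplitude: just after each \<open>X = 2 ^ k\<close>, on \<open>r + 1\<close>
  consecutive blocks of length \<open>h \<approx> X powr (1 - \<theta>)\<close>, where \<open>\<theta> = t \<delta> / (\<kappa> + 1/2)\<close>, the coefficient is proportional to
  \<open>(-1) ^ j (r choose j)\<close> on the \<open>j\<close>-th block.  Its Dirichlet polynomial is a sum of \<open>r\<close>-th finite differences of
  \<open>x powr (-z)\<close>, hence \<open>O((\<bar>z\<bar> h / X) powr \<kappa>)\<close> relative to the trivial bound as soon as \<open>r \<ge> \<kappa>\<close>; this converges
  beyond the line \<open>Re s = \<alpha> - \<delta>\<close> and is \<open>O(\<bar>s\<bar> powr \<kappa>)\<close> on it.

  The first two blocks make the second difference of the summatory function at \<open>X\<close>, \<open>X + h\<close>, \<open>X + 2h\<close>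
  as large as \<open>h (ln X) ^ (m - 1)\<close> times the size of the weights, whereas the residue is smooth in \<open>x\<close> and by Cauchy's
  inequality has a much smaller second difference.  So the error term cannot be small at all three points.
\<close>

section \<open>Finite differences of complex powers\<close>

text \<open>Pascal's rule splits each coefficient of order \<open>Suc r\<close> into two of order
  \<open>r\<close>, trading one order of the alternating sum for passing from \<open>f\<close> to
  its first difference. This drives the induction in \<open>finite_difference_bound\<close>.\<close>

lemma finite_difference_step:
  fixes f :: "real \<Rightarrow> complex"
  shows "(\<Sum>j\<le>Suc r. (-1) ^ j * of_nat (Suc r choose j) * f (x + real j * h)) =
         (\<Sum>j\<le>r. (-1) ^ j * of_nat (r choose j) *
            (f (x + real j * h) - f (x + real j * h + h)))"
proof -
  have "(\<Sum>j\<le>Suc r. (-1) ^ j * of_nat (Suc r choose j) * f (x + real j * h)) =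
        f x + (\<Sum>j\<le>r. (-1) ^ Suc j * of_nat (Suc r choose Suc j) * f (x + real (Suc j) * h))"
    by (subst sum.atMost_Suc_shift) simp
  also have "\<dots> = f x + ((\<Sum>j\<le>r. (-1) ^ Suc j * of_nat (r choose Suc j) * f (x + real (Suc j) * h))
        + (\<Sum>j\<le>r. (-1) ^ Suc j * of_nat (r choose j) * f (x + real (Suc j) * h)))"
    by (simp add: sum.distrib[symmetric] algebra_simps)
  also have "\<dots> = (f x + (\<Sum>j\<le>r. (-1) ^ Suc j * of_nat (r choose Suc j) * f (x + real (Suc j) * h)))
        + (\<Sum>j\<le>r. (-1) ^ Suc j * of_nat (r choose j) * f (x + real (Suc j) * h))"
    by simp
  also have "f x + (\<Sum>j\<le>r. (-1) ^ Suc j * of_nat (r choose Suc j) * f (x + real (Suc j) * h)) =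
        (\<Sum>j\<le>Suc r. (-1) ^ j * of_nat (r choose j) * f (x + real j * h))"
    by (subst sum.atMost_Suc_shift) simp
  also have "\<dots> = (\<Sum>j\<le>r. (-1) ^ j * of_nat (r choose j) * f (x + real j * h))"
    by simp
  finally show ?thesis
    by (simp add: sum.distrib[symmetric] algebra_simps sum_subtractf sum_negf)
qed

text \<open>Induction on \<open>r\<close>: the chain \<open>f\<close> of successive derivatives is
  replaced by the chain of its first differences with step \<open>h\<close>, and the mean value
  inequality at the top of the chain yields one factor \<open>h\<close> per order.\<close>

lemma finite_difference_bound:
  fixes f :: "nat \<Rightarrow> real \<Rightarrow> complex"
  assumes "\<And>i y. i < r \<Longrightarrow> x \<le> y \<Longrightarrow> (f i has_vector_derivative f (Suc i) y) (at y)"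
    and "\<And>y. x \<le> y \<Longrightarrow> cmod (f r y) \<le> B" and "0 \<le> h"
  shows "cmod (\<Sum>j\<le>r. (-1) ^ j * of_nat (r choose j) * f 0 (x + real j * h)) \<le> h ^ r * B"
  using assms
proof (induction r arbitrary: f B)
  case 0
  from "0.prems"(2)[of x] show ?case by simp
next
  case (Suc r)
  have "cmod (\<Sum>j\<le>r. (-1) ^ j * of_nat (r choose j) *
          (\<lambda>i y. f i y - f i (y + h)) 0 (x + real j * h)) \<le> h ^ r * (h * B)"
  proof (rule Suc.IH)
    fix i y assume iy: "i < r" "x \<le> y"
    have "((f i \<circ> (\<lambda>y. y + h)) has_vector_derivative 1 *\<^sub>R f (Suc i) (y + h)) (at y)"
      using Suc.prems(1)[of i "y + h"] iy Suc.prems(3)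
      by (intro vector_diff_chain_at) (auto intro!: derivative_eq_intros)
    then have s: "((\<lambda>y. f i (y + h)) has_vector_derivative f (Suc i) (y + h)) (at y)"
      by (simp add: o_def)
    show "((\<lambda>y. f i y - f i (y + h)) has_vector_derivative f (Suc i) y - f (Suc i) (y + h)) (at y)"
      using s Suc.prems(1)[of i y] iy by (auto intro!: derivative_eq_intros)
  next
    fix y assume y: "x \<le> y"
    have "norm (f r (y + h) - f r y) \<le> B * norm (y + h - y)"
    proof (rule differentiable_bound[where S = "{y..y+h}"])
      fix u assume "u \<in> {y..y+h}"
      then have u: "x \<le> u" using y by auto
      show "(f r has_derivative (\<lambda>t. t *\<^sub>R f (Suc r) u)) (at u within {y..y+h})"
        using Suc.prems(1)[of r u] u has_derivative_at_withinI
        by (auto simp: has_vector_derivative_def)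
      have "0 \<le> B" using Suc.prems(2)[OF u] norm_ge_zero order_trans by blast
      show "onorm (\<lambda>t. t *\<^sub>R f (Suc r) u) \<le> B"
        using Suc.prems(2)[OF u] by (intro onorm_le) (simp add: mult.commute[of B] mult_left_mono)
    qed (use Suc.prems(3) in auto)
    then show "cmod (f r y - f r (y + h)) \<le> h * B"
      using Suc.prems(3) by (simp add: norm_minus_commute mult.commute)
  qed (use Suc.prems in auto)
  then show ?case
    by (subst finite_difference_step) (simp add: mult_ac)
qed

lemma has_vector_derivative_complex_powr:
  assumes "0 < y"
  shows "((\<lambda>y. complex_of_real y powr w) has_vector_derivative
           w * complex_of_real y powr (w - 1)) (at y)"
  using assms by (intro has_vector_derivative_real_field has_field_derivative_powr)
    (auto simp: complex_nonpos_Reals_iff)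

text \<open>The derivatives of a power are falling factorials times lower powers. Since
  \<open>Re w \<le> real r\<close>, the one of order \<open>r\<close> is bounded by a nonincreasing
  function, so the left end \<open>x\<close> decides. It serves twice: with \<open>w = -z\<close>
  for the oscillation, and with order 2 for the residue.\<close>

lemma powr_finite_difference_bound:
  assumes "0 < x" "0 \<le> h" "Re w \<le> real r"
  shows "cmod (\<Sum>j\<le>r. (-1) ^ j * of_nat (r choose j) * complex_of_real (x + real j * h) powr w)
         \<le> h ^ r * ((cmod w + real r) ^ r * x powr (Re w - real r))"
proof -
  define f where "f i y = (\<Prod>l<i. w - of_nat l) * complex_of_real y powr (w - of_nat i)" for i y
  have "cmod (\<Sum>j\<le>r. (-1) ^ j * of_nat (r choose j) * f 0 (x + real j * h))
        \<le> h ^ r * ((cmod w + real r) ^ r * x powr (Re w - real r))"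
  proof (rule finite_difference_bound)
    fix i y assume "i < r" "x \<le> y"
    then have "0 < y" using assms by simp
    from has_vector_derivative_complex_powr[OF this, of "w - of_nat i"]
    have "((\<lambda>y. (\<Prod>l<i. w - of_nat l) * complex_of_real y powr (w - of_nat i))
      has_vector_derivative (\<Prod>l<i. w - of_nat l) *
        ((w - of_nat i) * complex_of_real y powr (w - of_nat i - 1))) (at y)"
      by (intro has_vector_derivative_mult_right)
    then show "(f i has_vector_derivative f (Suc i) y) (at y)"
      by (simp add: f_def[abs_def] algebra_simps)
  next
    fix y assume y: "x \<le> y"
    have "cmod (\<Prod>l<r. w - of_nat l) \<le> (\<Prod>l<r. cmod w + real r)"
      unfolding prod_norm[symmetric]
    proof (intro prod_mono conjI)
      fix l assume "l \<in> {..<r}"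
      then show "cmod (w - of_nat l) \<le> cmod w + real r"
        using norm_triangle_ineq4[of w "of_nat l"] by simp
    qed auto
    moreover have "cmod (complex_of_real y powr (w - of_nat r)) \<le> x powr (Re w - real r)"
      using y assms by (simp add: norm_powr_real_powr powr_mono2')
    ultimately show "cmod (f r y) \<le> (cmod w + real r) ^ r * x powr (Re w - real r)"
      by (simp add: f_def norm_mult mult_mono)
  qed (use assms in auto)
  then show ?thesis by (simp add: f_def)
qed

lemma powr_finite_difference_trivial_bound:
  assumes "0 < x" "0 \<le> h" "Re w \<le> 0"
  shows "cmod (\<Sum>j\<le>r. (-1) ^ j * of_nat (r choose j) * complex_of_real (x + real j * h) powr w)
         \<le> 2 ^ r * x powr Re w"
proof -
  have "cmod (\<Sum>j\<le>r. (-1) ^ j * of_nat (r choose j) * complex_of_real (x + real j * h) powr w)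
        \<le> (\<Sum>j\<le>r. real (r choose j) * x powr Re w)"
  proof (rule sum_norm_le)
    fix j
    have "(x + real j * h) powr Re w \<le> x powr Re w"
      using assms by (intro powr_mono2') auto
    then show "cmod ((-1) ^ j * of_nat (r choose j) * complex_of_real (x + real j * h) powr w)
      \<le> real (r choose j) * x powr Re w"
      using assms by (simp add: norm_mult norm_power norm_powr_real_powr mult_left_mono del: of_real_add)
  qed
  also have "\<dots> = real (\<Sum>j\<le>r. r choose j) * x powr Re w"
    by (simp add: sum_distrib_right)
  finally show ?thesis unfolding choose_row_sum by simp
qed

text \<open>Interpolation between the trivial bound and the bound by the \<open>r\<close>-th derivative.\<close>

lemma powr_finite_difference_interpolated_bound:
  assumes "0 < x" "0 < h" "Re w \<le> 0" "0 < r" "0 \<le> \<kappa>" "\<kappa> \<le> real r"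
  shows "cmod (\<Sum>j\<le>r. (-1) ^ j * of_nat (r choose j) * complex_of_real (x + real j * h) powr w)
         \<le> 2 ^ r * (cmod w + real r) powr \<kappa> * (h / x) powr \<kappa> * x powr Re w"
    (is "cmod ?D \<le> _")
proof -
  \<comment> \<open>\<open>Y\<close> is the gain per derivative. Relative to
    \<open>x powr Re w\<close>, the two bounds at hand are \<open>2 ^ r\<close> and
    \<open>Y ^ r\<close>; for \<open>Y \<ge> 1\<close> the first suffices, and for
    \<open>Y < 1\<close> the exponent \<open>r\<close> may be lowered to
    \<open>\<kappa>\<close>.\<close>
  define Y where "Y = (cmod w + real r) * (h / x)"
  have Y0: "0 < Y" using assms by (simp add: Y_def add_nonneg_pos)
  have Yk: "(cmod w + real r) powr \<kappa> * (h / x) powr \<kappa> = Y powr \<kappa>"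
    unfolding Y_def by (rule powr_mult[symmetric])
  have "cmod ?D \<le> 2 ^ r * Y powr \<kappa> * x powr Re w"
  proof (cases "1 \<le> Y")
    case True
    then have "2 ^ r * 1 * x powr Re w \<le> 2 ^ r * Y powr \<kappa> * x powr Re w"
      using assms by (intro mult_right_mono mult_left_mono ge_one_powr_ge_zero) auto
    moreover have "cmod ?D \<le> 2 ^ r * 1 * x powr Re w"
      using powr_finite_difference_trivial_bound[of x h w r] assms by simp
    ultimately show ?thesis by (rule order_trans[rotated])
  next
    case False
    have "cmod ?D \<le> h ^ r * ((cmod w + real r) ^ r * x powr (Re w - real r))"
      using assms by (intro powr_finite_difference_bound) auto
    also have "\<dots> = Y powr real r * x powr Re w"
      using assms Y0 by (simp add: powr_diff powr_realpow Y_def power_mult_distrib power_divide)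
    also have "\<dots> \<le> Y powr \<kappa> * x powr Re w"
      using False Y0 assms by (intro mult_right_mono powr_mono') auto
    also have "\<dots> \<le> 2 ^ r * (Y powr \<kappa> * x powr Re w)"
      using mult_right_mono[of 1 "2 ^ r" "Y powr \<kappa> * x powr Re w"] by simp
    finally show ?thesis by (simp add: mult.assoc)
  qed
  then show ?thesis by (simp add: Yk mult.assoc)
qed

section \<open>Series with a summable majorant and the continuation of zeta\<close>

text \<open>A Weierstrass test whose majorant may grow with \<open>z\<close>: the continuous factor
  \<open>G\<close> is bounded on compact discs, so convergence is locally uniform. Keeping
  \<open>h\<close> and \<open>G\<close> apart lets the sum inherit the growth rate
  \<open>G\<close>.\<close>

lemma holomorphic_series_of_summable_bound:
  fixes f :: "nat \<Rightarrow> complex \<Rightarrow> complex"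
  assumes S: "open S" and hol: "\<And>n. f n holomorphic_on S"
    and h: "summable h" and G: "continuous_on S G"
    and bound: "\<And>n z. z \<in> S \<Longrightarrow> cmod (f n z) \<le> h n * G z"
    and h0: "\<And>n. 0 \<le> h n"
  obtains g where "g holomorphic_on S" "\<And>z. z \<in> S \<Longrightarrow> (\<lambda>n. f n z) sums g z"
    "\<And>z. z \<in> S \<Longrightarrow> cmod (g z) \<le> suminf h * G z"
proof -
  have "\<exists>g g'. \<forall>x\<in>S. (\<lambda>n. f n x) sums g x \<and> (\<lambda>n. deriv (f n) x) sums g' x \<and>
          (g has_field_derivative g' x) (at x)"
  proof (rule series_and_derivative_comparison_complex[OF S])
    fix n x assume "x \<in> S"
    then show "(f n has_field_derivative deriv (f n) x) (at x)"
      using hol S holomorphic_derivI by blast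
  next
    fix x assume x: "x \<in> S"
    then obtain d where d: "d > 0" "cball x d \<subseteq> S"
      using open_contains_cball_eq[OF S] by auto
    have "compact (G ` cball x d)"
      by (rule compact_continuous_image[OF continuous_on_subset[OF G]]) (use d in auto)
    then obtain B where B: "B > 0" "\<And>y. y \<in> cball x d \<Longrightarrow> norm (G y) \<le> B"
      using compact_imp_bounded[of "G ` cball x d"] by (auto simp: bounded_pos)
    have "cmod (f n y) \<le> cmod (complex_of_real (h n * B))" if "y \<in> ball x d" for n y
    proof -
      have "cmod (f n y) \<le> h n * G y" using that d by (intro bound) auto
      also have "\<dots> \<le> h n * B" using B(2)[of y] that h0 by (intro mult_left_mono) auto
      finally show ?thesis by (simp add: norm_of_real del: of_real_mult)
    qed
    then show "\<exists>d h. 0 < d \<and> summable h \<and> range h \<subseteq> \<real>\<^sub>\<ge>\<^sub>0 \<and>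
        (\<forall>\<^sub>F n in sequentially. \<forall>y\<in>ball x d \<inter> S. cmod (f n y) \<le> cmod (h n))"
      using d B h0 h
      by (intro exI[of _ d] exI[of _ "\<lambda>n. complex_of_real (h n * B)"])
         (auto simp: summable_of_real summable_mult2 simp del: of_real_mult)
  qed
  then obtain g g' where g: "\<And>x. x \<in> S \<Longrightarrow> (\<lambda>n. f n x) sums g x"
    "\<And>x. x \<in> S \<Longrightarrow> (g has_field_derivative g' x) (at x)" by blast
  have "cmod (g z) \<le> suminf h * G z" if z: "z \<in> S" for z
  proof -
    have s: "summable (\<lambda>n. h n * G z)" using h by (rule summable_mult2)
    have "g z = (\<Sum>n. f n z)" using g(1)[OF z] sums_unique by blast
    also have "cmod \<dots> \<le> (\<Sum>n. h n * G z)"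
      using bound[OF z] s by (intro norm_suminf_le) auto
    finally show ?thesis using h by (simp add: suminf_mult2)
  qed
  moreover have "g holomorphic_on S"
    using g(2) S by (auto simp: holomorphic_on_open)
  ultimately show thesis using g(1) that by blast
qed

text \<open>Interpolation of order 1 with exponent 1/2: growth
  \<open>\<bar>z\<bar> powr (1/2)\<close> buys decay \<open>x powr (-1/2)\<close>. Together with
  \<open>Re z > 3/4\<close> the exponent is -5/4, which is summable.\<close>

lemma powr_diff_bound:
  assumes "1 \<le> x" "x \<le> y" "y \<le> x + 1" "3/4 < Re z"
  shows "cmod (complex_of_real y powr (-z) - complex_of_real x powr (-z))
         \<le> 2 * (cmod z + 1) powr (1/2) * x powr (-5/4)"
proof (cases "x = y")
  case False
  have "cmod (\<Sum>j\<le>1. (-1) ^ j * of_nat (1 choose j) * complex_of_real (x + real j * (y - x)) powr (-z))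
         \<le> 2 ^ 1 * (cmod (-z) + real 1) powr (1/2) * ((y - x) / x) powr (1/2) * x powr Re (-z)"
    using assms False by (intro powr_finite_difference_interpolated_bound) auto
  also have "(\<Sum>j\<le>1. (-1) ^ j * of_nat (1 choose j) * complex_of_real (x + real j * (y - x)) powr (-z))
      = complex_of_real x powr (-z) - complex_of_real y powr (-z)"
    by simp
  also have "2 ^ 1 * (cmod (-z) + real 1) powr (1/2) * ((y - x) / x) powr (1/2) * x powr Re (-z)
     \<le> 2 ^ 1 * (cmod (-z) + real 1) powr (1/2) * (1 / x) powr (1/2) * x powr (-3/4)"
    using assms by (intro mult_mono powr_mono2 powr_mono divide_right_mono) auto
  also have "\<dots> = 2 * (cmod z + 1) powr (1/2) * x powr (-5/4)"
    using assms by (simp add: powr_divide powr_minus powr_add[symmetric] divide_simps)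
  finally show ?thesis by (simp add: norm_minus_commute)
qed (use assms in simp)

text \<open>First-order Taylor remainder on \<open>[x, x+1]\<close>: the derivative is
  \<open>1 - z\<close> times a power whose variation \<open>powr_diff_bound\<close> controls. The
  factor \<open>cmod (z - 1)\<close> is kept because it is divided out later.\<close>

lemma zeta_taylor_error_bound:
  assumes "3/4 < Re z" "1 \<le> x"
  shows "cmod (complex_of_real (x + 1) powr (1 - z) - complex_of_real x powr (1 - z)
           - (1 - z) * complex_of_real x powr (-z))
         \<le> x powr (-5/4) * (2 * cmod (z - 1) * (cmod z + 1) powr (1/2))"
proof -
  define f where "f = (\<lambda>y. complex_of_real y powr (1 - z))"
  define f' where "f' = (\<lambda>y. (1 - z) * complex_of_real y powr (-z))"
  define B where "B = cmod (1 - z) * (2 * (cmod z + 1) powr (1/2) * x powr (-5/4))"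
  have d: "(f has_vector_derivative f' y) (at y within {x..x+1})" if y: "y \<in> {x..x+1}" for y
  proof -
    have "0 < y" "1 - z - 1 = - z" using y assms by auto
    from has_vector_derivative_complex_powr[OF this(1), of "1 - z", unfolded this(2)]
    have "(f has_vector_derivative f' y) (at y)"
      unfolding f_def f'_def .
    then show ?thesis by (rule has_vector_derivative_at_within)
  qed
  have b: "norm (f' y - f' x) \<le> B" if y: "y \<in> {x..x+1}" for y
      unfolding right_diff_distrib[symmetric] norm_mult f'_def B_def
      using powr_diff_bound[of x y z] assms y by (intro mult_left_mono) auto
  have c: "closed_segment x (x + 1) \<subseteq> {x..x+1}"
    by (simp add: closed_segment_eq_real_ivl)
  have "norm (f (x + 1) - f x - (x + 1 - x) *\<^sub>R f' x) \<le> norm (x + 1 - x) * B"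
    by (rule vector_differentiable_bound_linearization[OF d c b]) auto
  then show ?thesis by (simp add: f_def f'_def B_def norm_minus_commute mult_ac)
qed

lemma summable_Suc_powr: "s < -1 \<Longrightarrow> summable (\<lambda>n. real (Suc n) powr s)"
  using summable_real_powr_iff[of s] summable_Suc_iff[of "\<lambda>n. real n powr s"] by simp

lemma Suc_powr_tendsto_0:
  assumes "1 < Re z"
  shows "(\<lambda>n. complex_of_real (real (Suc n)) powr (1 - z)) \<longlonglongrightarrow> 0"
proof (rule Lim_null_comparison)
  show "\<forall>\<^sub>F n in sequentially. cmod (complex_of_real (real (Suc n)) powr (1 - z)) \<le> real (Suc n) powr (1 - Re z)"
    by (intro always_eventually allI) (simp add: norm_powr_real_powr del: of_nat_Suc)
  show "(\<lambda>n. real (Suc n) powr (1 - Re z)) \<longlonglongrightarrow> 0"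
    using assms by (intro tendsto_neg_powr filterlim_compose[OF filterlim_real_sequentially filterlim_Suc]) auto
qed

text \<open>\<open>1 / (z - 1) + E z\<close> is the Riemann zeta function. Summing the Taylor
  remainders \<open>\<tau> n z\<close> telescopes the differences to -1 and leaves
  \<open>(z - 1)\<close> times zeta, so their sum \<open>T z\<close> is
  \<open>(z - 1) * zeta(z) - 1\<close> for \<open>Re z > 1\<close>, and it converges for
  \<open>Re z > 3/4\<close>.\<close>

lemma zeta_continuation:
  obtains E C where "E holomorphic_on {z. 3/4 < Re z}" "0 \<le> C"
    "\<And>z. 3/4 < Re z \<Longrightarrow> cmod (E z) \<le> C * (cmod z + 1) powr (1/2)"
    "\<And>z. 1 < Re z \<Longrightarrow> (\<lambda>n. complex_of_real (real (Suc n)) powr (-z)) sums (1 / (z - 1) + E z)"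
proof -
  let ?S = "{z. 3/4 < Re z}"
  define \<tau> where "\<tau> n z = complex_of_real (real (Suc n) + 1) powr (1 - z)
      - complex_of_real (real (Suc n)) powr (1 - z)
      - (1 - z) * complex_of_real (real (Suc n)) powr (-z)" for n z
  have S: "open ?S" by (rule open_halfspace_Re_gt)
  have "summable (\<lambda>n. real (Suc n) powr (-5/4))" by (rule summable_Suc_powr) simp
  then obtain T where T: "T holomorphic_on ?S" "\<And>z. z \<in> ?S \<Longrightarrow> (\<lambda>n. \<tau> n z) sums T z"
    "\<And>z. z \<in> ?S \<Longrightarrow> cmod (T z) \<le> (\<Sum>n. real (Suc n) powr (-5/4)) *
       (2 * cmod (z - 1) * (cmod z + 1) powr (1/2))"
  proof (rule holomorphic_series_of_summable_bound[OF S, rotated])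
    show "\<tau> n holomorphic_on ?S" for n
      unfolding \<tau>_def by (intro holomorphic_intros)
    show "continuous_on ?S (\<lambda>z. 2 * cmod (z - 1) * (cmod z + 1) powr (1/2))"
      by (intro continuous_intros) (auto simp: add_nonneg_eq_0_iff)
    show "cmod (\<tau> n z) \<le> real (Suc n) powr (-5/4) * (2 * cmod (z - 1) * (cmod z + 1) powr (1/2))"
      if "z \<in> ?S" for n z
      unfolding \<tau>_def using that by (intro zeta_taylor_error_bound) auto
  qed auto
  define C where "C = 2 * (\<Sum>n. real (Suc n) powr (-5/4))"
  \<comment> \<open>The bound on \<open>T\<close> contains \<open>cmod (z - 1)\<close>, so
    \<open>T\<close> vanishes at 1, the quotient extends holomorphically, and dividing by
    \<open>z - 1\<close> leaves the growth exponent 1/2.\<close>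
  define E where "E z = (if z = 1 then deriv T 1 else (T z - T 1) / (z - 1))" for z
  have one: "1 \<in> ?S" by simp
  have C0: "0 \<le> C" unfolding C_def
    by (intro mult_nonneg_nonneg suminf_nonneg summable_Suc_powr) auto
  have T1: "T 1 = 0" using T(3)[OF one] by simp
  have E: "E holomorphic_on ?S"
    unfolding E_def using T(1) one S by (intro pole_lemma) (auto simp: interior_open)
  have bound': "cmod (E z) \<le> C * (cmod z + 1) powr (1/2)" if "3/4 < Re z" "z \<noteq> 1" for z
    using T(3)[of z] that by (simp add: E_def T1 norm_divide C_def field_simps)
  have bound: "cmod (E z) \<le> C * (cmod z + 1) powr (1/2)" if z: "3/4 < Re z" for z
  proof (cases "z = 1")
    case True
    have ev: "\<forall>\<^sub>F w in at 1. w \<in> ?S"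
      using S one eventually_at_topological by blast
    have cE: "isCont E 1"
      using E S one continuous_on_eq_continuous_at holomorphic_on_imp_continuous_on by blast
    \<comment> \<open>Division by \<open>cmod (z - 1)\<close> says nothing at 1 itself; the bound
      passes there by continuity.\<close>
    have "cmod (E 1) \<le> C * (cmod 1 + 1) powr (1/2)"
    proof (rule tendsto_le[of "at (1::complex)"])
      show "((\<lambda>w. cmod (E w)) \<longlongrightarrow> cmod (E 1)) (at 1)"
        using cE by (intro tendsto_intros) (simp add: isCont_def)
      show "((\<lambda>w. C * (cmod w + 1) powr (1/2)) \<longlongrightarrow> C * (cmod 1 + 1) powr (1/2)) (at (1::complex))"
        by (intro tendsto_intros) auto
      show "\<forall>\<^sub>F w in at 1. cmod (E w) \<le> C * (cmod w + 1) powr (1/2)"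
        using ev eventually_neq_at_within[of 1 1 UNIV] 
        by eventually_elim (use bound' in auto)
    qed auto
    with True show ?thesis by simp
  qed (use bound' z in auto)
  have "(\<lambda>n. complex_of_real (real (Suc n)) powr (-z)) sums (1 / (z - 1) + E z)" if z: "1 < Re z" for z
  proof -
    have z1: "z \<noteq> 1" using z by auto
    have t: "(\<lambda>n. complex_of_real (real (Suc (Suc n))) powr (1 - z)
        - complex_of_real (real (Suc n)) powr (1 - z)) sums
        (0 - complex_of_real (real (Suc 0)) powr (1 - z))"
      using Suc_powr_tendsto_0[OF z] by (rule telescope_sums)
    have "(\<lambda>n. \<tau> n z) sums T z" using z by (intro T(2)) auto
    from sums_diff[OF t this]
    have "(\<lambda>n. (1 - z) * complex_of_real (real (Suc n)) powr (-z)) sums (-1 - T z)"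
      by (simp add: \<tau>_def add.commute)
    from sums_mult[OF this, of "1 / (1 - z)"]
    have "(\<lambda>n. complex_of_real (real (Suc n)) powr (-z)) sums (1 / (1 - z) * (-1 - T z))"
      using z1 by simp
    moreover have "1 / (1 - z) * (-1 - T z) = 1 / (z - 1) + E z"
      using z1 by (simp add: E_def T1 divide_simps) (simp add: algebra_simps)
    ultimately show ?thesis by simp
  qed
  then show thesis using that E C0 bound by blast
qed

section \<open>Powers of the logarithm as coefficients: derivatives of zeta\<close>

lemma ln_power_le_powr:
  fixes e :: real
  assumes "0 < e"
  obtains C where "0 < C" "\<And>x::real. 1 \<le> x \<Longrightarrow> ln x ^ q \<le> C * x powr e"
proof -
  \<comment> \<open>The exponent \<open>e\<close> is shared among the \<open>q\<close> logarithms;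
    the \<open>+ 1\<close> covers \<open>q = 0\<close>.\<close>
  define a where "a = e / (real q + 1)"
  have a: "0 < a" "a * real q \<le> e" using assms by (auto simp: a_def field_simps)
  have "ln x ^ q \<le> (1 / a ^ q) * x powr e" if x: "1 \<le> x" for x :: real
  proof -
    have "ln x ^ q \<le> (x powr a / a) ^ q"
      using x a ln_powr_bound[OF x, of a] by (intro power_mono) auto
    also have "\<dots> = (1 / a ^ q) * x powr (a * real q)"
      using x by (simp add: power_divide powr_powr[symmetric] powr_realpow)
    also have "\<dots> \<le> (1 / a ^ q) * x powr e"
      using x a by (intro mult_left_mono powr_mono) auto
    finally show ?thesis .
  qed
  then show thesis using that[of "1 / a ^ q"] a by auto
qed

lemma has_field_derivative_inverse_power:
  assumes "z \<noteq> (1::complex)"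
  shows "((\<lambda>z. fact q / (z - 1) ^ Suc q) has_field_derivative - (fact (Suc q) / (z - 1) ^ Suc (Suc q))) (at z)"
proof -
  define u where "u = z - 1"
  have u: "u \<noteq> 0" using assms by (simp add: u_def)
  have "((\<lambda>z. (z - 1) ^ Suc q) has_field_derivative of_nat (Suc q) * (z - 1) ^ q) (at z)"
    using DERIV_power[OF DERIV_diff[OF DERIV_ident[of "at z"] DERIV_const[of "1::complex"]], where n = "Suc q"]
    by simp
  from DERIV_cmult[OF DERIV_inverse'[OF this], of "fact q"] u
  have "((\<lambda>z. fact q * inverse ((z - 1) ^ Suc q)) has_field_derivative
      fact q * - (inverse (u ^ Suc q) * (of_nat (Suc q) * u ^ q) * inverse (u ^ Suc q))) (at z)"
    by (simp add: u_def)
  also have "fact q * - (inverse (u ^ Suc q) * (of_nat (Suc q) * u ^ q) * inverse (u ^ Suc q))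
      = - (fact (Suc q) / u ^ Suc (Suc q))"
    using u by (simp add: divide_simps)
  finally show ?thesis by (simp only: u_def divide_inverse)
qed

lemma has_field_derivative_powr_uminus:
  fixes w :: complex
  assumes "w \<noteq> 0"
  shows "((\<lambda>z. w powr (- z)) has_field_derivative - (Ln w * w powr (- z))) (at z)"
  using DERIV_chain2[OF has_field_derivative_powr_right[OF assms] DERIV_minus[OF DERIV_ident]]
  by simp

text \<open>Each termwise differentiation brings down a factor \<open>- ln\<close>. The principal
  part acquires the same sign \<open>(-1) ^ q\<close>, which cancels there and stays in front of the
  derivative of \<open>E\<close>. The half-plane \<open>Re z > 2\<close> only has to tie the series
  to its continuation; there the logarithms cost 1/2 and the exponent -3/2 is summable.\<close>

lemma log_power_dirichlet_series:
  assumes E: "E holomorphic_on {z. 3/4 < Re z}"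
    and zeta: "\<And>z. 1 < Re z \<Longrightarrow> (\<lambda>n. complex_of_real (real (Suc n)) powr (-z)) sums (1 / (z - 1) + E z)"
    and "2 < Re z"
  shows "(\<lambda>n. complex_of_real (ln (real (Suc n)) ^ q) * complex_of_real (real (Suc n)) powr (-z)) sums
           (fact q / (z - 1) ^ Suc q + (-1) ^ q * (deriv ^^ q) E z)"
  using assms(3)
proof (induction q arbitrary: z)
  case 0
  then show ?case using zeta[of z] by simp
next
  case (Suc q)
  let ?S = "{z. 2 < Re z}"
  let ?f = "\<lambda>q n z. complex_of_real (ln (real (Suc n)) ^ q) * complex_of_real (real (Suc n)) powr (-z)"
  let ?g = "\<lambda>q z. fact q / (z - 1) ^ Suc q + (-1) ^ q * (deriv ^^ q) E z"
  have S: "open ?S" by (rule open_halfspace_Re_gt)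
  have S': "open {z. 3/4 < Re z}" by (rule open_halfspace_Re_gt)
  obtain C where C: "0 < C" "\<And>x::real. 1 \<le> x \<Longrightarrow> ln x ^ q \<le> C * x powr (1/2)"
    using ln_power_le_powr[of "1/2" q] by auto
  have "\<exists>g g'. \<forall>x\<in>?S. (\<lambda>n. ?f q n x) sums g x \<and> (\<lambda>n. - ?f (Suc q) n x) sums g' x \<and>
          (g has_field_derivative g' x) (at x)"
  proof (rule series_and_derivative_comparison_complex[OF S])
    fix n and x :: complex
    show "(?f q n has_field_derivative - ?f (Suc q) n x) (at x)"
      using DERIV_cmult[OF has_field_derivative_powr_uminus[of "complex_of_real (real (Suc n))" x],
          of "complex_of_real (ln (real (Suc n)) ^ q)"]
      by (simp add: Ln_of_real mult_ac del: of_nat_Suc of_real_of_nat_eq)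
  next
    fix x assume x: "x \<in> ?S"
    have "cmod (?f q n y) \<le> cmod (complex_of_real (C * real (Suc n) powr (-3/2)))"
      if y: "y \<in> ball x 1 \<inter> ?S" for n y
    proof -
      have "cmod (?f q n y) = ln (real (Suc n)) ^ q * real (Suc n) powr (- Re y)"
        by (simp add: norm_mult norm_power norm_powr_real_powr ln_ge_zero del: of_nat_Suc)
      also have "\<dots> \<le> (C * real (Suc n) powr (1/2)) * real (Suc n) powr (-2)"
        using y by (intro mult_mono C(2) powr_mono) (use C(1) in auto)
      also have "\<dots> = C * real (Suc n) powr (-3/2)"
        by (simp add: powr_add[symmetric] del: of_nat_Suc)
      finally show ?thesis using C(1) by (simp add: norm_mult)
    qed
    moreover have "summable (\<lambda>n. complex_of_real (C * real (Suc n) powr (-3/2)))"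
      by (intro summable_of_real summable_mult summable_Suc_powr) auto
    moreover have "range (\<lambda>n. complex_of_real (C * real (Suc n) powr (-3/2))) \<subseteq> \<real>\<^sub>\<ge>\<^sub>0"
      using C(1) by (auto simp del: of_nat_Suc of_real_mult)
    ultimately show "\<exists>d h. 0 < d \<and> summable h \<and> range h \<subseteq> \<real>\<^sub>\<ge>\<^sub>0 \<and>
        (\<forall>\<^sub>F n in sequentially. \<forall>y\<in>ball x d \<inter> ?S. cmod (?f q n y) \<le> cmod (h n))"
      by (intro exI[of _ 1] exI[of _ "\<lambda>n. complex_of_real (C * real (Suc n) powr (-3/2))"]) auto
  qed
  then obtain g g' where g: "\<And>x. x \<in> ?S \<Longrightarrow> (\<lambda>n. ?f q n x) sums g x"
    "\<And>x. x \<in> ?S \<Longrightarrow> (\<lambda>n. - ?f (Suc q) n x) sums g' x"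
    "\<And>x. x \<in> ?S \<Longrightarrow> (g has_field_derivative g' x) (at x)" by blast
  have z: "z \<in> ?S" using Suc.prems by simp
  have gq: "g x = ?g q x" if "x \<in> ?S" for x
    using g(1)[OF that] Suc.IH[of x] that sums_unique2 by blast
  \<comment> \<open>The sum of the series and the closed form agree on an open half-plane, hence so
    do their derivatives; uniqueness of derivatives then evaluates the differentiated
    series.\<close>
  have "(?g q has_field_derivative g' z) (at z)"
  proof (rule has_field_derivative_transform_within_open[OF g(3)[OF z] S z])
    fix x assume "x \<in> ?S" then show "g x = ?g q x" by (rule gq)
  qed
  moreover have "(?g q has_field_derivative
      - (fact (Suc q) / (z - 1) ^ Suc (Suc q)) + (-1) ^ q * (deriv ^^ (Suc q)) E z) (at z)"
    using Suc.prems has_field_derivative_higher_deriv[OF E S', of z q]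
    by (intro DERIV_add DERIV_cmult has_field_derivative_inverse_power) auto
  ultimately have "g' z = - ?g (Suc q) z"
    using DERIV_unique by fastforce
  with sums_minus[OF g(2)[OF z]] show ?case by simp
qed

section \<open>The dyadic oscillation\<close>

text \<open>The length of one block after \<open>2 ^ k\<close>. Division by
  \<open>real r + 1\<close> makes all \<open>r + 1\<close> blocks together at most
  \<open>(2 ^ k) powr (1 - \<theta>)\<close> long, so they fit into the dyadic interval.\<close>

definition block_step :: "real \<Rightarrow> nat \<Rightarrow> nat \<Rightarrow> nat" where
  "block_step \<theta> r k = nat \<lfloor>(2 ^ k) powr (1 - \<theta>) / (real r + 1)\<rfloor>"

text \<open>
  Index \<open>n\<close> belongs to the summand \<open>(n + 1) powr (-z)\<close>.  Past block \<open>r\<close> the coefficient vanishes because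
  \<open>r choose j = 0\<close>; without the case \<open>h = 0\<close>, division by \<open>0\<close> would put every index into block \<open>0\<close>.
\<close>

definition oscillation :: "real \<Rightarrow> nat \<Rightarrow> nat \<Rightarrow> nat \<Rightarrow> real" where
  "oscillation \<theta> r q n = (let k = floor_log n; h = block_step \<theta> r k; j = (n - 2 ^ k) div h in
     if h = 0 then 0 else (-1) ^ j * real (r choose j) * ln (2 ^ k) ^ q / 2 ^ r)"

lemma floor_log_eqI:
  assumes "2 ^ k \<le> n" "n < 2 ^ Suc k"
  shows "floor_log n = k"
proof -
  have n: "0 < n" using assms by (cases n) auto
  have "2 ^ floor_log n < (2::nat) ^ Suc k" "2 ^ k < (2::nat) ^ Suc (floor_log n)"
    using floor_log_exp2_le[OF n] floor_log_exp2_gt[of n] assms by auto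
  then have "floor_log n < Suc k" "k < Suc (floor_log n)"
    using power_less_imp_less_exp[of "2::nat"] by (simp_all only: one_less_numeral_iff semiring_norm)
  then show ?thesis by simp
qed

lemma block_step_le:
  assumes "0 \<le> \<theta>"
  shows "real (block_step \<theta> r k) * (real r + 1) \<le> (2 ^ k) powr (1 - \<theta>)"
    "(r + 1) * block_step \<theta> r k \<le> 2 ^ k"
proof -
  have "real (block_step \<theta> r k) \<le> (2 ^ k) powr (1 - \<theta>) / (real r + 1)"
    unfolding block_step_def by simp
  then show *: "real (block_step \<theta> r k) * (real r + 1) \<le> (2 ^ k) powr (1 - \<theta>)"
    by (simp add: field_simps)
  also have "(2 ^ k :: real) powr (1 - \<theta>) \<le> (2 ^ k) powr 1"
    using assms by (intro powr_mono) auto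
  finally have "real ((r + 1) * block_step \<theta> r k) \<le> real (2 ^ k)"
    by (simp add: algebra_simps)
  then show "(r + 1) * block_step \<theta> r k \<le> 2 ^ k"
    by (simp only: of_nat_le_iff)
qed

lemma oscillation_block:
  assumes "m < 2 ^ k"
  shows "oscillation \<theta> r q (2 ^ k + m) = (if block_step \<theta> r k = 0 then 0 else
    (-1) ^ (m div block_step \<theta> r k) * real (r choose (m div block_step \<theta> r k)) * ln (2 ^ k) ^ q / 2 ^ r)"
proof -
  have "floor_log (2 ^ k + m) = k" using assms by (intro floor_log_eqI) auto
  then show ?thesis by (simp add: oscillation_def Let_def)
qed

text \<open>Writing the offset from \<open>2 ^ k\<close> as \<open>i + j * h\<close> with
  \<open>i < h\<close> and summing over \<open>j\<close> first groups the points that occupy the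
  same position in all blocks. Each inner sum is then a finite difference of order \<open>r\<close>
  and step \<open>h\<close>.\<close>

lemma oscillation_block_sum:
  fixes F :: "nat \<Rightarrow> complex"
  assumes "0 \<le> \<theta>"
  shows "(\<Sum>n = 2 ^ k..<2 ^ Suc k. of_real (oscillation \<theta> r q n) * F n) =
    of_real (ln (2 ^ k) ^ q / 2 ^ r) * (\<Sum>i<block_step \<theta> r k. \<Sum>j\<le>r.
       (-1) ^ j * of_nat (r choose j) * F (2 ^ k + i + j * block_step \<theta> r k))"
proof (cases "block_step \<theta> r k = 0")
  case True
  have "oscillation \<theta> r q n = 0" if "n \<in> {2 ^ k..<2 ^ Suc k}" for n
    using oscillation_block[of "n - 2 ^ k" k \<theta> r q] that True by auto
  then show ?thesis using True by simp
next
  case False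
  define h where "h = block_step \<theta> r k"
  have h: "h > 0" using False by (simp add: h_def)
  define v where "v = complex_of_real (ln (2 ^ k) ^ q / 2 ^ r)"
  have o: "complex_of_real (oscillation \<theta> r q (2 ^ k + m)) =
      v * ((-1) ^ (m div h) * of_nat (r choose (m div h)))" if "m < 2 ^ k" for m
    using oscillation_block[OF that, of \<theta> r q] False by (simp add: h_def v_def)
  have "(\<Sum>n = 2 ^ k..<2 ^ Suc k. of_real (oscillation \<theta> r q n) * F n) =
      (\<Sum>m<2 ^ k. of_real (oscillation \<theta> r q (2 ^ k + m)) * F (2 ^ k + m))"
    using sum.shift_bounds_nat_ivl[of "\<lambda>n. of_real (oscillation \<theta> r q n) * F n" 0 "2 ^ k" "2 ^ k"]
    by (simp add: atLeast0LessThan add.commute mult_2)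
  also have "\<dots> = (\<Sum>m<2 ^ k. v * ((-1) ^ (m div h) * of_nat (r choose (m div h)) * F (2 ^ k + m)))"
    by (intro sum.cong refl) (simp add: o)
  also have "\<dots> = (\<Sum>m<(r + 1) * h. v * ((-1) ^ (m div h) * of_nat (r choose (m div h)) * F (2 ^ k + m)))"
  proof (rule sum.mono_neutral_right)
    show "{..<(r + 1) * h} \<subseteq> {..<2 ^ k}"
      using block_step_le(2)[OF assms, of r k] by (auto simp: h_def)
    show "\<forall>i\<in>{..<2 ^ k} - {..<(r + 1) * h}. v * ((-1) ^ (i div h) * of_nat (r choose (i div h)) * F (2 ^ k + i)) = 0"
    proof
      fix i assume "i \<in> {..<2 ^ k} - {..<(r + 1) * h}"
      then have "r + 1 \<le> i div h" using h by (auto simp: less_eq_div_iff_mult_less_eq)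
      then show "v * ((-1) ^ (i div h) * of_nat (r choose (i div h)) * F (2 ^ k + i)) = 0"
        by simp
    qed
  qed auto
  also have "\<dots> = (\<Sum>j<r + 1. \<Sum>m = j * h..<j * h + h.
      v * ((-1) ^ (m div h) * of_nat (r choose (m div h)) * F (2 ^ k + m)))"
    by (rule sum.nat_group[symmetric])
  also have "\<dots> = (\<Sum>j<r + 1. \<Sum>i<h. v * ((-1) ^ j * of_nat (r choose j) * F (2 ^ k + i + j * h)))"
  proof (rule sum.cong[OF refl])
    fix j
    have "(\<Sum>m = j * h..<j * h + h. v * ((-1) ^ (m div h) * of_nat (r choose (m div h)) * F (2 ^ k + m)))
      = (\<Sum>i<h. v * ((-1) ^ ((i + j * h) div h) * of_nat (r choose ((i + j * h) div h)) * F (2 ^ k + (i + j * h))))"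
      using sum.shift_bounds_nat_ivl[of "\<lambda>m. v * ((-1) ^ (m div h) * of_nat (r choose (m div h)) * F (2 ^ k + m))" 0 "j * h" h]
      by (simp add: atLeast0LessThan add.commute)
    also have "\<dots> = (\<Sum>i<h. v * ((-1) ^ j * of_nat (r choose j) * F (2 ^ k + i + j * h)))"
      using h by (intro sum.cong refl) (simp add: add.assoc)
    finally show "(\<Sum>m = j * h..<j * h + h. v * ((-1) ^ (m div h) * of_nat (r choose (m div h)) * F (2 ^ k + m)))
      = (\<Sum>i<h. v * ((-1) ^ j * of_nat (r choose j) * F (2 ^ k + i + j * h)))" .
  qed
  also have "\<dots> = (\<Sum>i<h. \<Sum>j\<le>r. v * ((-1) ^ j * of_nat (r choose j) * F (2 ^ k + i + j * h)))"
    by (subst sum.swap) (simp add: lessThan_Suc_atMost)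
  finally show ?thesis
    by (simp add: sum_distrib_left v_def h_def)
qed

text \<open>The division by \<open>2 ^ r\<close> in the oscillation outweighs every binomial
  coefficient. This is what keeps the combined coefficients nonnegative.\<close>

lemma abs_oscillation_le:
  assumes "0 \<le> \<theta>" "0 < r"
  shows "\<bar>oscillation \<theta> r q n\<bar> \<le> ln (real (Suc n)) ^ q"
proof (cases "n = 0")
  case True
  \<comment> \<open>\<open>floor_log 0\<close> is 0, so index 0 is treated as if it lay after
    \<open>2 ^ 0\<close>; at least two blocks would have to fit into length 1, which forces block
    length 0.\<close>
  have "block_step \<theta> r 0 = 0" using block_step_le(2)[of \<theta> r 0] assms
    by (cases "block_step \<theta> r 0") auto
  then show ?thesis using True by (simp add: oscillation_def)
next
  case False
  define k where "k = floor_log n"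
  define j where "j = (n - 2 ^ k) div block_step \<theta> r k"
  have le: "2 ^ k \<le> n" unfolding k_def using False by (intro floor_log_exp2_le) auto
  have "real (2 ^ k) \<le> real (Suc n)" using le by (simp only: of_nat_le_iff)
  then have ln: "ln (2 ^ k) ^ q \<le> ln (real (Suc n)) ^ q"
    by (intro power_mono) auto
  have "real (r choose j) \<le> 2 ^ r"
    using binomial_le_pow2[of r j] by (metis of_nat_le_iff of_nat_numeral of_nat_power)
  then have "real (r choose j) * ln (2 ^ k) ^ q \<le> 2 ^ r * ln (2 ^ k) ^ q"
    by (intro mult_right_mono) auto
  then have "real (r choose j) * ln (2 ^ k) ^ q / 2 ^ r \<le> ln (2 ^ k) ^ q"
    by (simp add: field_simps)
  moreover have "\<bar>oscillation \<theta> r q n\<bar> \<le> real (r choose j) * ln (2 ^ k) ^ q / 2 ^ r"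
    unfolding oscillation_def Let_def k_def[symmetric] j_def[symmetric]
    by (auto simp: abs_mult power_abs)
  ultimately show ?thesis using ln by linarith
qed

text \<open>Index 0 lies in no interval from \<open>2 ^ k\<close> to \<open>2 ^ Suc k\<close>; its
  vanishing makes the dyadic sums exhaust the series.\<close>

lemma oscillation_0: "0 < r \<Longrightarrow> 0 \<le> \<theta> \<Longrightarrow> oscillation \<theta> r q 0 = 0"
  using block_step_le(2)[of \<theta> r 0]
  by (cases "block_step \<theta> r 0") (auto simp: oscillation_def)

definition oscillation_block_term :: "real \<Rightarrow> nat \<Rightarrow> nat \<Rightarrow> nat \<Rightarrow> complex \<Rightarrow> complex" where
  "oscillation_block_term \<theta> r q k z =
     (\<Sum>n = 2 ^ k..<2 ^ Suc k. of_real (oscillation \<theta> r q n) * complex_of_real (real (Suc n)) powr (-z))"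

text \<open>The block sum consists of \<open>h\<close> finite differences, each bounded by
  interpolation with \<open>h / x \<le> X powr (-\<theta>)\<close>; the number \<open>h\<close> of
  them costs another \<open>X powr (1 - \<theta>)\<close>. The normalisation \<open>2 ^ r\<close>
  cancels.\<close>

lemma oscillation_block_bound:
  assumes "0 < \<theta>" "0 < r" "0 < \<kappa>" "\<kappa> \<le> real r" "0 \<le> Re z"
    and "1 - \<theta> * (\<kappa> + 1/2) - \<theta> / 4 \<le> Re z"
  shows "cmod (oscillation_block_term \<theta> r q k z)
    \<le> ln (2 ^ k) ^ q * (2 ^ k) powr (- \<theta> / 4) * (cmod z + real r) powr \<kappa>"
proof -
  define X where "X = (2 ^ k :: real)"
  define h where "h = block_step \<theta> r k"
  define B where "B = 2 ^ r * (cmod z + real r) powr \<kappa> * X powr (- \<theta> * \<kappa> - Re z)"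
  have X: "1 \<le> X" by (simp add: X_def)
  have "real h * 1 \<le> real h * (real r + 1)" by (intro mult_left_mono) auto
  also have "\<dots> \<le> X powr (1 - \<theta>)"
    using block_step_le(1)[of \<theta> r k] assms by (simp add: h_def X_def)
  finally have h: "real h \<le> X powr (1 - \<theta>)" by simp
  have inner: "cmod (\<Sum>j\<le>r. (-1) ^ j * of_nat (r choose j) *
      complex_of_real (real (Suc (2 ^ k + i + j * h))) powr (-z)) \<le> B" if "i < h" for i
  proof -
    define x where "x = X + real i + 1"
    have x: "X \<le> x" "0 < x" "0 < h" using X that by (auto simp: x_def)
    have e: "real (Suc (2 ^ k + i + j * h)) = x + real j * real h" for j
      by (simp add: x_def X_def)
    have "cmod (\<Sum>j\<le>r. (-1) ^ j * of_nat (r choose j) * complex_of_real (x + real j * real h) powr (-z))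
      \<le> 2 ^ r * (cmod (-z) + real r) powr \<kappa> * (real h / x) powr \<kappa> * x powr Re (-z)"
      using assms x by (intro powr_finite_difference_interpolated_bound) auto
    also have "\<dots> \<le> 2 ^ r * (cmod (-z) + real r) powr \<kappa> * (X powr (-\<theta>)) powr \<kappa> * X powr Re (-z)"
    proof -
      have "real h / x \<le> X powr (1 - \<theta>) / X"
        using h x X by (intro frac_le) auto
      also have "\<dots> = X powr (-\<theta>)" using X by (simp add: powr_diff powr_minus divide_simps)
      finally have "(real h / x) powr \<kappa> \<le> (X powr (-\<theta>)) powr \<kappa>"
        using assms x by (intro powr_mono2) auto
      moreover have "x powr Re (-z) \<le> X powr Re (-z)"
        using assms x X by (intro powr_mono2') auto
      ultimately show ?thesis by (intro mult_mono) auto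
    qed
    also have "\<dots> = B"
      unfolding B_def mult.assoc powr_powr powr_add[symmetric] by simp
    finally show ?thesis unfolding e .
  qed
  have "cmod (oscillation_block_term \<theta> r q k z) = ln X ^ q / 2 ^ r * cmod (\<Sum>i<h. \<Sum>j\<le>r.
      (-1) ^ j * of_nat (r choose j) * complex_of_real (real (Suc (2 ^ k + i + j * h))) powr (-z))"
    unfolding oscillation_block_term_def
    using assms X by (subst oscillation_block_sum)
      (auto simp: norm_mult h_def X_def norm_divide norm_power simp del: of_nat_Suc)
  also have "\<dots> \<le> ln X ^ q / 2 ^ r * (\<Sum>i<h. B)"
    using X by (intro mult_left_mono sum_norm_le inner) auto
  also have "\<dots> \<le> ln X ^ q / 2 ^ r * (X powr (1 - \<theta>) * B)"
    using h X by (intro mult_left_mono) (auto simp: B_def intro!: mult_right_mono)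
  also have "\<dots> = ln X ^ q * (cmod z + real r) powr \<kappa> * X powr (1 - \<theta> + (- \<theta> * \<kappa> - Re z))"
    by (simp add: B_def powr_add)
  \<comment> \<open>The exponent is
    \<open>1 - \<theta> * (\<kappa> + 1/2) - Re z - \<theta>/2\<close>. Of the surplus
    \<open>\<theta>/2\<close>, one half pays for going beyond the critical line and the other half
    remains as decay.\<close>
  also have "\<dots> \<le> ln X ^ q * (cmod z + real r) powr \<kappa> * X powr (- \<theta> / 4)"
    using assms X by (intro mult_left_mono powr_mono) (auto simp: algebra_simps)
  finally show ?thesis by (simp add: X_def mult_ac)
qed

section \<open>The combined Dirichlet series and its growth\<close>

lemma summable_dyadic_log_powr:
  fixes e :: real
  assumes "0 < e"
  shows "summable (\<lambda>k. ln (2 ^ k :: real) ^ q * (2 ^ k) powr (- e))"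
proof -
  \<comment> \<open>Half of the exponent absorbs the logarithms; the other half leaves a geometric
    series.\<close>
  obtain C where C: "0 < C" "\<And>x::real. 1 \<le> x \<Longrightarrow> ln x ^ q \<le> C * x powr (e / 2)"
    using ln_power_le_powr[of "e / 2" q] assms by auto
  show ?thesis
  proof (rule summable_comparison_test)
    show "\<exists>N. \<forall>k\<ge>N. norm (ln (2 ^ k) ^ q * (2 ^ k :: real) powr (- e)) \<le> C * (2 powr (- e / 2)) ^ k"
    proof (intro exI[of _ 0] allI impI)
      fix k :: nat
      have "norm (ln (2 ^ k) ^ q * (2 ^ k :: real) powr (- e)) = ln (2 ^ k) ^ q * (2 ^ k) powr (- e)"
        by (simp add: abs_mult power_abs)
      also have "\<dots> \<le> C * (2 ^ k) powr (e / 2) * (2 ^ k) powr (- e)"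
        by (intro mult_right_mono C) auto
      also have "\<dots> = C * (2 ^ k) powr (- e / 2)"
        by (simp add: powr_add[symmetric])
      also have "(2 ^ k :: real) powr (- e / 2) = (2 powr (- e / 2)) ^ k"
        by (simp add: powr_realpow[symmetric] powr_powr mult.commute)
      finally show "norm (ln (2 ^ k) ^ q * (2 ^ k :: real) powr (- e)) \<le> C * (2 powr (- e / 2)) ^ k" .
    qed
    have "(2::real) powr (- e / 2) < 2 powr 0"
      using assms by (intro powr_less_mono) auto
    then show "summable (\<lambda>k. C * (2 powr (- e / 2)) ^ k)"
      by (intro summable_mult summable_geometric) auto
  qed
qed

lemma summable_log_power_dirichlet:
  assumes "\<And>n. \<bar>c n\<bar> \<le> ln (real (Suc n)) ^ q" "2 < Re z"
  shows "summable (\<lambda>n. complex_of_real (c n) * complex_of_real (real (Suc n)) powr (-z))"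
proof -
  obtain C where C: "0 < C" "\<And>x::real. 1 \<le> x \<Longrightarrow> ln x ^ q \<le> C * x powr (1/2)"
    using ln_power_le_powr[of "1/2" q] by auto
  show ?thesis
  proof (rule summable_comparison_test)
    show "summable (\<lambda>n. C * real (Suc n) powr (-3/2))"
      by (intro summable_mult summable_Suc_powr) auto
    have "cmod (complex_of_real (c n) * complex_of_real (real (Suc n)) powr (-z))
        \<le> C * real (Suc n) powr (-3/2)" for n
    proof -
      have "cmod (complex_of_real (c n) * complex_of_real (real (Suc n)) powr (-z))
          = \<bar>c n\<bar> * real (Suc n) powr (- Re z)"
        by (simp add: norm_mult norm_powr_real_powr del: of_nat_Suc)
      also have "\<dots> \<le> (C * real (Suc n) powr (1/2)) * real (Suc n) powr (-2)"
        using assms C(1) order_trans[OF assms(1)[of n] C(2)[of "real (Suc n)"]]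
        by (intro mult_mono powr_mono) auto
      also have "\<dots> = C * real (Suc n) powr (-3/2)"
        by (simp add: powr_add[symmetric] del: of_nat_Suc)
      finally show ?thesis .
    qed
    then show "\<exists>N. \<forall>n\<ge>N. cmod (complex_of_real (c n) * complex_of_real (real (Suc n)) powr (-z))
        \<le> C * real (Suc n) powr (-3/2)" by blast
  qed
qed

text \<open>\<open>P\<close> is summed block by block, so that the cancellation inside each block
  counts. For \<open>Re z > 2\<close> the terms themselves are absolutely summable, which identifies
  \<open>P\<close> with the Dirichlet series.\<close>

lemma oscillation_series:
  assumes "0 < \<theta>" "0 < r" "0 < \<kappa>" "\<kappa> \<le> real r" "\<theta> * (\<kappa> + 1/2) + \<theta> / 4 \<le> 1"
  obtains P C where "P holomorphic_on {z. 1 - \<theta> * (\<kappa> + 1/2) - \<theta> / 4 < Re z}" "0 \<le> C"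
    "\<And>z. 1 - \<theta> * (\<kappa> + 1/2) - \<theta> / 4 < Re z \<Longrightarrow> cmod (P z) \<le> C * (cmod z + real r) powr \<kappa>"
    "\<And>z. 2 < Re z \<Longrightarrow> (\<lambda>n. complex_of_real (oscillation \<theta> r q n) *
        complex_of_real (real (Suc n)) powr (-z)) sums P z"
proof -
  let ?S = "{z. 1 - \<theta> * (\<kappa> + 1/2) - \<theta> / 4 < Re z}"
  define b where "b k = ln (2 ^ k) ^ q * (2 ^ k :: real) powr (- \<theta> / 4)" for k :: nat
  have sb: "summable b"
    unfolding b_def using summable_dyadic_log_powr[of "\<theta> / 4" q] assms by simp
  have S: "open ?S" by (rule open_halfspace_Re_gt)
  have hol: "oscillation_block_term \<theta> r q k holomorphic_on ?S" for k
    unfolding oscillation_block_term_def[abs_def] by (intro holomorphic_intros)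
  have cont: "continuous_on ?S (\<lambda>z. (cmod z + real r) powr \<kappa>)"
    using assms by (intro continuous_intros) (auto simp: add_nonneg_eq_0_iff)
  have bound: "cmod (oscillation_block_term \<theta> r q k z) \<le> b k * (cmod z + real r) powr \<kappa>"
    if "z \<in> ?S" for k z
    unfolding b_def using assms that by (intro oscillation_block_bound) auto
  have b0: "0 \<le> b k" for k by (simp add: b_def)
  obtain P where P: "P holomorphic_on ?S"
    "\<And>z. z \<in> ?S \<Longrightarrow> (\<lambda>k. oscillation_block_term \<theta> r q k z) sums P z"
    "\<And>z. z \<in> ?S \<Longrightarrow> cmod (P z) \<le> suminf b * (cmod z + real r) powr \<kappa>"
    using holomorphic_series_of_summable_bound[OF S hol sb cont bound b0] by blast
  have "(\<lambda>n. complex_of_real (oscillation \<theta> r q n) * complex_of_real (real (Suc n)) powr (-z)) sums P z"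
    if z: "2 < Re z" for z
  proof -
    define t where "t n = complex_of_real (oscillation \<theta> r q n) * complex_of_real (real (Suc n)) powr (-z)" for n
    have "summable t"
      unfolding t_def using assms z by (intro summable_log_power_dirichlet[where q = q] abs_oscillation_le) auto
    then have t: "(\<lambda>N. \<Sum>n<N. t n) \<longlonglongrightarrow> suminf t" by (rule summable_LIMSEQ)
    \<comment> \<open>Partial sums over whole blocks are the subsequence of partial sums at
      \<open>2 ^ k\<close>, hence have the same limit.\<close>
    have "strict_mono (\<lambda>k. 2 ^ k :: nat)" by (simp add: strict_mono_def)
    from LIMSEQ_subseq_LIMSEQ[OF t this]
    have "(\<lambda>k. \<Sum>n<2 ^ k. t n) \<longlonglongrightarrow> suminf t" by (simp add: o_def)
    moreover have "(\<Sum>i<k. oscillation_block_term \<theta> r q i z) = (\<Sum>n<2 ^ k. t n)" for k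
    proof (induction k)
      case 0
      show ?case using assms by (simp add: t_def oscillation_0 lessThan_Suc)
    next
      case (Suc k)
      have "{..<2 ^ Suc k} = {..<2 ^ k} \<union> {2 ^ k..<2 ^ Suc k :: nat}" by auto
      then have "(\<Sum>n<2 ^ Suc k. t n) = (\<Sum>n<2 ^ k. t n) + (\<Sum>n = 2 ^ k..<2 ^ Suc k. t n)"
        by (simp add: sum.union_disjoint ivl_disj_int)
      then show ?case using Suc.IH by (simp add: oscillation_block_term_def t_def)
    qed
    moreover have "0 \<le> \<theta> * (\<kappa> + 1/2)" using assms by simp
    then have "1 - \<theta> * (\<kappa> + 1/2) - \<theta> / 4 < Re z" using assms(1) z by linarith
    then have "z \<in> ?S" by simp
    ultimately have "suminf t = P z"
      using P(2)[of z] LIMSEQ_unique by (auto simp: sums_def)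
    then have "t sums P z" using summable_sums[OF \<open>summable t\<close>] by simp
    then show ?thesis by (simp only: t_def[abs_def])
  qed
  moreover have "0 \<le> suminf b" using sb by (intro suminf_nonneg) (auto simp: b_def)
  ultimately show thesis using that[OF P(1)] P(3) by blast
qed

text \<open>Cauchy's inequality on a disc of radius 1/16: from \<open>Re z \<ge> 27/32\<close> it
  reaches only to 25/32, still to the right of 3/4, so differentiation preserves the growth exponent
  1/2.\<close>

lemma higher_deriv_halfplane_bound:
  assumes E: "E holomorphic_on {z. 3/4 < Re z}" and C: "0 \<le> C"
    and bound: "\<And>z. 3/4 < Re z \<Longrightarrow> cmod (E z) \<le> C * (cmod z + 1) powr (1/2)"
    and z: "27/32 \<le> Re z"
  shows "cmod ((deriv ^^ q) E z) \<le> fact q * (C * (cmod z + 2) powr (1/2)) / (1/16) ^ q"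
proof (rule Cauchy_inequality)
  have sub: "cball z (1/16) \<subseteq> {z. 3/4 < Re z}"
  proof
    fix w assume "w \<in> cball z (1/16)"
    then show "w \<in> {z. 3/4 < Re z}"
      using abs_Re_le_cmod[of "z - w"] z by (simp add: dist_norm)
  qed
  show "E holomorphic_on ball z (1/16)"
    using ball_subset_cball sub by (rule holomorphic_on_subset[OF E order_trans])
  show "continuous_on (cball z (1/16)) E"
    using holomorphic_on_imp_continuous_on[OF holomorphic_on_subset[OF E sub]] .
  fix w assume w: "norm (z - w) = 1/16"
  then have "w \<in> cball z (1/16)" by (simp add: dist_norm)
  then have "3/4 < Re w" using sub by blast
  then have "cmod (E w) \<le> C * (cmod w + 1) powr (1/2)" by (rule bound)
  also have "\<dots> \<le> C * (cmod z + 2) powr (1/2)"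
    using C w norm_triangle_ineq3[of z w] by (intro mult_left_mono powr_mono2) auto
  finally show "norm (E w) \<le> C * (cmod z + 2) powr (1/2)" .
qed simp

text \<open>\<open>G\<close> collects the holomorphic part of the zeta derivative and the
  oscillation. The bound 5/32 keeps the region inside \<open>Re z > 27/32\<close>, where the Cauchy
  estimate is available; it arises as 1/8 for \<open>t * \<delta>\<close> plus 1/32 for
  \<open>\<theta> / 4\<close>.\<close>

lemma oscillating_dirichlet_series:
  assumes "0 < \<theta>" "0 < r" "1/2 < \<kappa>" "\<kappa> \<le> real r" "\<theta> * (\<kappa> + 1/2) + \<theta> / 4 \<le> 5/32"
  obtains G C where "G holomorphic_on {z. 1 - \<theta> * (\<kappa> + 1/2) - \<theta> / 4 < Re z}" "0 \<le> C"
    "\<And>z. 1 - \<theta> * (\<kappa> + 1/2) - \<theta> / 4 < Re z \<Longrightarrow> cmod (G z) \<le> C * (cmod z + real r) powr \<kappa>"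
    "\<And>z. 2 < Re z \<Longrightarrow> (\<lambda>n. complex_of_real (ln (real (Suc n)) ^ q + oscillation \<theta> r q n) *
        complex_of_real (real (Suc n)) powr (-z)) sums (fact q / (z - 1) ^ Suc q + G z)"
proof -
  let ?S = "{z. 1 - \<theta> * (\<kappa> + 1/2) - \<theta> / 4 < Re z}"
  obtain P CP where P: "P holomorphic_on ?S" "0 \<le> CP"
    "\<And>z. 1 - \<theta> * (\<kappa> + 1/2) - \<theta> / 4 < Re z \<Longrightarrow> cmod (P z) \<le> CP * (cmod z + real r) powr \<kappa>"
    "\<And>z. 2 < Re z \<Longrightarrow> (\<lambda>n. complex_of_real (oscillation \<theta> r q n) *
        complex_of_real (real (Suc n)) powr (-z)) sums P z"
    using oscillation_series[of \<theta> r \<kappa> q] assms by auto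
  obtain E CE where E: "E holomorphic_on {z. 3/4 < Re z}" "0 \<le> CE"
    "\<And>z. 3/4 < Re z \<Longrightarrow> cmod (E z) \<le> CE * (cmod z + 1) powr (1/2)"
    "\<And>z. 1 < Re z \<Longrightarrow> (\<lambda>n. complex_of_real (real (Suc n)) powr (-z)) sums (1 / (z - 1) + E z)"
    using zeta_continuation by blast
  define G where "G z = (-1) ^ q * (deriv ^^ q) E z + P z" for z
  define C where "C = 2 * (fact q * CE / (1/16) ^ q) + CP"
  have sub: "?S \<subseteq> {z. 3/4 < Re z}" using assms by auto
  have "(deriv ^^ q) E holomorphic_on ?S"
    by (rule holomorphic_on_subset[OF holomorphic_higher_deriv[OF E(1) open_halfspace_Re_gt] sub])
  then have "G holomorphic_on ?S"
    unfolding G_def by (intro holomorphic_on_add holomorphic_on_mult holomorphic_on_const P(1))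
  moreover have "0 \<le> C" using E(2) P(2) by (simp add: C_def)
  moreover have "cmod (G z) \<le> C * (cmod z + real r) powr \<kappa>"
    if z: "1 - \<theta> * (\<kappa> + 1/2) - \<theta> / 4 < Re z" for z
  proof -
    define Y where "Y = cmod z + real r"
    have r: "1 \<le> real r" using assms(2) by simp
    have Y: "1 \<le> Y" using r norm_ge_zero[of z] unfolding Y_def by linarith
    have "cmod z + 2 \<le> 2 * Y"
      using r norm_ge_zero[of z] unfolding Y_def distrib_left by linarith
    then have "(cmod z + 2) powr (1/2) \<le> (2 * Y) powr (1/2)"
      by (intro powr_mono2) auto
    \<comment> \<open>Here \<open>\<kappa> > 1/2\<close> lets the growth of the zeta part disappear
      in that of the oscillation.\<close>
    also have "\<dots> \<le> 2 powr 1 * Y powr \<kappa>"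
      unfolding powr_mult using Y assms by (intro mult_mono powr_mono) auto
    finally have *: "(cmod z + 2) powr (1/2) \<le> 2 * Y powr \<kappa>" by simp
    have "cmod ((deriv ^^ q) E z) \<le> fact q * (CE * (cmod z + 2) powr (1/2)) / (1/16) ^ q"
      using assms z by (intro higher_deriv_halfplane_bound E) auto
    also have "\<dots> \<le> fact q * (CE * (2 * Y powr \<kappa>)) / (1/16) ^ q"
      using * E(2) by (intro divide_right_mono mult_left_mono) auto
    finally have "cmod ((deriv ^^ q) E z) \<le> 2 * (fact q * CE / (1/16) ^ q) * Y powr \<kappa>"
      by (simp add: mult_ac)
    moreover have "cmod (P z) \<le> CP * Y powr \<kappa>" using P(3)[OF z] by (simp add: Y_def)
    moreover have "cmod (G z) \<le> cmod ((deriv ^^ q) E z) + cmod (P z)"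
      unfolding G_def by (rule order_trans[OF norm_triangle_ineq]) (simp add: norm_mult norm_power)
    ultimately show ?thesis by (simp add: C_def Y_def distrib_right)
  qed
  moreover have "(\<lambda>n. complex_of_real (ln (real (Suc n)) ^ q + oscillation \<theta> r q n) *
        complex_of_real (real (Suc n)) powr (-z)) sums (fact q / (z - 1) ^ Suc q + G z)"
    if z: "2 < Re z" for z
    using sums_add[OF log_power_dirichlet_series[OF E(1,4) z, of q] P(4)[OF z]]
    by (simp only: of_real_add distrib_right G_def add.assoc)
  ultimately show thesis by (rule that)
qed

section \<open>Verification of Hypothesis B\<close>

text \<open>Multiplying by \<open>(s - of_real \<alpha>) ^ m\<close> gives a holomorphic
  \<open>g\<close> with value \<open>c \<noteq> 0\<close> at the pole, which fixes its order.
  Polynomial growth of \<open>H\<close> gives both growth conditions, the principal part being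
  harmless away from the pole.\<close>

lemma hypothesis_B_pole_plus_holomorphic:
  assumes par: "0 < \<alpha>" "0 < \<delta>" "\<delta> < \<alpha>" "0 \<le> \<kappa>" "1 \<le> m"
    and a: "\<And>n. 1 \<le> n \<Longrightarrow> 0 \<le> a n"
    and series: "\<And>s. \<sigma> < Re s \<Longrightarrow>
      (\<lambda>n. of_real (a (Suc n)) * of_real (l (Suc n)) powr (- s)) sums (c / (s - of_real \<alpha>) ^ m + H s)"
    and c: "c \<noteq> 0" and H: "H holomorphic_on {s. b < Re s}" and b: "b < \<alpha> - \<delta>"
    and C: "0 \<le> C" and bound: "\<And>s. \<alpha> - \<delta> \<le> Re s \<Longrightarrow> cmod (H s) \<le> C * (cmod s + 1) powr \<kappa>"
  shows "hypothesis_B a l (\<lambda>s. c / (s - of_real \<alpha>) ^ m + H s) \<alpha> \<delta> \<kappa> m"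
proof -
  define A where "A s = c / (s - of_real \<alpha>) ^ m + H s" for s
  define g where "g s = c + (s - of_real \<alpha>) ^ m * H s" for s
  let ?S = "{s. b < Re s}"
  have S: "open ?S" by (rule open_halfspace_Re_gt)
  have \<alpha>S: "of_real \<alpha> \<in> ?S" using par b by simp
  have g: "g holomorphic_on ?S" unfolding g_def by (intro holomorphic_intros H)
  have g\<alpha>: "g (of_real \<alpha>) = c" using par by (simp add: g_def)
  have Ag: "A s = g s / (s - of_real \<alpha>) ^ m" if "s \<noteq> of_real \<alpha>" for s
    using that by (simp add: A_def g_def add_divide_distrib)
  have "A holomorphic_on ?S - {of_real \<alpha>}"
    unfolding A_def by (intro holomorphic_intros holomorphic_on_subset[OF H]) auto
  moreover have "open (?S - {of_real \<alpha>})" using S by (rule open_delete)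
  ultimately have "A analytic_on (?S - {of_real \<alpha>})" by (simp add: analytic_on_open)
  then have "A analytic_on ({s. \<alpha> - \<delta> \<le> Re s} - {of_real \<alpha>})"
    by (rule analytic_on_subset) (use b in auto)
  moreover have "is_pole A (of_real \<alpha>)"
  proof -
    have "isCont g (of_real \<alpha>)"
      using g S \<alpha>S continuous_on_eq_continuous_at holomorphic_on_imp_continuous_on by blast
    moreover have "filterlim (\<lambda>s. (s - of_real \<alpha>) ^ m) (at 0) (at (of_real \<alpha> :: complex))"
    proof (rule filterlim_atI)
      show "((\<lambda>s. (s - of_real \<alpha>) ^ m) \<longlongrightarrow> 0) (at (of_real \<alpha> :: complex))"
        using par by (auto intro!: tendsto_eq_intros)
      show "\<forall>\<^sub>F s in at (of_real \<alpha> :: complex). (s - of_real \<alpha>) ^ m \<noteq> 0"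
        by (rule eventually_mono[OF eventually_neq_at_within[of "of_real \<alpha>" "of_real \<alpha>" UNIV]]) simp
    qed
    ultimately have "is_pole (\<lambda>s. g s / (s - of_real \<alpha>) ^ m) (of_real \<alpha>)"
      using g\<alpha> c by (intro is_pole_divide) auto
    moreover have ev: "\<forall>\<^sub>F s in at (of_real \<alpha>). A s = g s / (s - of_real \<alpha>) ^ m"
      using Ag by (auto simp: eventually_at intro!: exI[of _ 1])
    ultimately show ?thesis using is_pole_cong[OF ev refl] by simp
  qed
  moreover have "zorder A (of_real \<alpha>) = - int m"
  proof (rule zorder_eqI[OF S \<alpha>S g])
    show "g (of_real \<alpha>) \<noteq> 0" using g\<alpha> c by simp
    fix s assume "s \<noteq> complex_of_real \<alpha>"
    then show "A s = g s * (s - of_real \<alpha>) powi (- int m)"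
      by (simp add: Ag power_int_minus divide_inverse)
  qed
  moreover have "\<exists>M1 M2 :: real. M1 \<ge> 0 \<and> M2 \<ge> 0 \<and>
        (\<forall>s. \<alpha> - \<delta> \<le> Re s \<and> Re s \<le> \<alpha> \<longrightarrow>
           cmod ((s - of_real \<alpha>) ^ m * A s) \<le> M1 * exp (cmod s powr M2))"
  proof (intro exI conjI allI impI)
    \<comment> \<open>\<open>p\<close> is the total degree of growth of \<open>g\<close>. From
      \<open>y + 1 \<le> exp y\<close> and \<open>p * y \<le> p\<^sup>2 + y\<^sup>2\<close> a power
      \<open>(y + 1) powr p\<close> is at most \<open>exp (p\<^sup>2) * exp (y\<^sup>2)\<close>,
      whence \<open>M\<close> and the exponent 2.\<close>
    define p where "p = real m + \<kappa>"
    define M where "M = (cmod c + (1 + \<alpha>) ^ m * C) * exp (p ^ 2)"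
    show "0 \<le> M" using C par by (auto simp: M_def)
    show "0 \<le> (2::real)" by simp
    fix s assume "\<alpha> - \<delta> \<le> Re s \<and> Re s \<le> \<alpha>"
    then have s: "\<alpha> - \<delta> \<le> Re s" by simp
    define y where "y = cmod s"
    have y: "0 \<le> y" by (simp add: y_def)
    have p: "0 \<le> p" using par by (simp add: p_def)
    have "cmod (s - of_real \<alpha>) \<le> y + \<alpha>"
      using norm_triangle_ineq4[of s "of_real \<alpha>"] par by (simp add: y_def)
    also have "\<dots> \<le> (1 + \<alpha>) * (y + 1)" using par y by (simp add: algebra_simps)
    finally have d: "cmod (s - of_real \<alpha>) ^ m \<le> (1 + \<alpha>) ^ m * (y + 1) ^ m"
      unfolding power_mult_distrib[symmetric] by (intro power_mono) auto
    \<comment> \<open>At the pole the left side is 0 because \<open>m \<ge> 1\<close>; elsewhere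
      equality holds.\<close>
    have "cmod ((s - of_real \<alpha>) ^ m * A s) \<le> cmod (g s)"
      using par by (cases "s = of_real \<alpha>") (auto simp: Ag power_0_left)
    also have "\<dots> \<le> cmod c + cmod (s - of_real \<alpha>) ^ m * cmod (H s)"
      unfolding g_def by (rule order_trans[OF norm_triangle_ineq]) (simp add: norm_mult norm_power)
    also have "\<dots> \<le> cmod c + ((1 + \<alpha>) ^ m * (y + 1) ^ m) * (C * (y + 1) powr \<kappa>)"
      using bound[OF s] d par y C by (intro add_left_mono mult_mono) (auto simp: y_def)
    also have "\<dots> = cmod c + ((1 + \<alpha>) ^ m * C) * (y + 1) powr p"
      using y by (simp add: p_def powr_add powr_realpow mult_ac)
    also have "\<dots> \<le> cmod c * (y + 1) powr p + ((1 + \<alpha>) ^ m * C) * (y + 1) powr p"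
      using y p by (intro add_right_mono) (simp add: mult_le_cancel_left1 ge_one_powr_ge_zero)
    also have "\<dots> = (cmod c + (1 + \<alpha>) ^ m * C) * (y + 1) powr p" by (simp add: algebra_simps)
    also have "\<dots> \<le> (cmod c + (1 + \<alpha>) ^ m * C) * exp (p ^ 2 + y ^ 2)"
    proof (rule mult_left_mono)
      have "(y + 1) powr p \<le> exp y powr p"
        using y p exp_ge_add_one_self[of y] by (intro powr_mono2) (auto simp: add.commute)
      also have "\<dots> = exp (p * y)" by (simp add: powr_def)
      also have "p * y \<le> p ^ 2 + y ^ 2"
      proof -
        have "0 \<le> (p - y) ^ 2" "0 \<le> p * y" using p y by auto
        then show ?thesis by (simp add: power2_diff)
      qed
      finally show "(y + 1) powr p \<le> exp (p ^ 2 + y ^ 2)" by simp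
    qed (use C par in auto)
    also have "\<dots> = M * exp (cmod s powr 2)"
      using y by (simp add: M_def exp_add y_def)
    finally show "cmod ((s - of_real \<alpha>) ^ m * A s) \<le> M * exp (cmod s powr 2)" .
  qed
  moreover have "\<exists>C::real. C \<ge> 1 \<and> (\<forall>s. Re s = \<alpha> - \<delta> \<longrightarrow>
           cmod (A s) \<le> C * (1 + \<bar>Im s\<bar>) powr \<kappa> * ln (3 + \<bar>Im s\<bar>) ^ (m - 1))"
  proof (intro exI conjI allI impI)
    \<comment> \<open>On the line the distance to the pole is at least \<open>\<delta>\<close>, and
      \<open>cmod s + 1\<close> is at most \<open>1 + \<alpha>\<close> times
      \<open>1 + \<bar>Im s\<bar>\<close>.\<close>
    define D where "D = cmod c / \<delta> ^ m + C * (1 + \<alpha>) powr \<kappa>"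
    have D: "0 \<le> D" using par C by (simp add: D_def)
    show "1 \<le> max 1 D" by simp
    fix s assume s: "Re s = \<alpha> - \<delta>"
    define y where "y = 1 + \<bar>Im s\<bar>"
    have y: "1 \<le> y" by (simp add: y_def)
    \<comment> \<open>As 3 exceeds \<open>exp 1\<close>, the logarithmic factor is at least 1 and
      may be inserted into a bound free of logarithms.\<close>
    have "ln (exp 1) \<le> ln (3 + \<bar>Im s\<bar>)"
      using exp_le by (subst ln_le_cancel_iff) auto
    then have l: "1 \<le> ln (3 + \<bar>Im s\<bar>) ^ (m - 1)" by (intro one_le_power) simp
    have "\<delta> \<le> cmod (s - of_real \<alpha>)"
      using abs_Re_le_cmod[of "s - of_real \<alpha>"] s by simp
    then have "\<delta> ^ m \<le> cmod (s - of_real \<alpha>) ^ m" using par by (intro power_mono) auto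
    then have 1: "cmod (c / (s - of_real \<alpha>) ^ m) \<le> cmod c / \<delta> ^ m"
      using par unfolding norm_divide norm_power by (intro divide_left_mono mult_pos_pos) (auto intro: less_le_trans[of _ "\<delta> ^ m"])
    have "cmod s \<le> \<alpha> + \<bar>Im s\<bar>" using cmod_le[of s] s par by simp
    moreover have "0 \<le> \<alpha> * \<bar>Im s\<bar>" using par by simp
    moreover have "(1 + \<alpha>) * y = 1 + \<alpha> + \<bar>Im s\<bar> + \<alpha> * \<bar>Im s\<bar>" by (simp add: y_def algebra_simps)
    ultimately have "cmod s + 1 \<le> (1 + \<alpha>) * y" by linarith
    then have "(cmod s + 1) powr \<kappa> \<le> ((1 + \<alpha>) * y) powr \<kappa>" using par by (intro powr_mono2) auto
    then have "C * (cmod s + 1) powr \<kappa> \<le> C * (1 + \<alpha>) powr \<kappa> * y powr \<kappa>"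
      using C by (simp add: powr_mult mult_left_mono mult.assoc)
    then have 2: "cmod (H s) \<le> C * (1 + \<alpha>) powr \<kappa> * y powr \<kappa>" using bound[of s] s by simp
    have yk: "1 \<le> y powr \<kappa>" using y par by (simp add: ge_one_powr_ge_zero)
    have "cmod (A s) \<le> cmod c / \<delta> ^ m * 1 + C * (1 + \<alpha>) powr \<kappa> * y powr \<kappa>"
      unfolding A_def using 1 2 norm_triangle_ineq[of "c / (s - of_real \<alpha>) ^ m" "H s"] by simp
    also have "\<dots> \<le> cmod c / \<delta> ^ m * y powr \<kappa> + C * (1 + \<alpha>) powr \<kappa> * y powr \<kappa>"
      using yk par by (intro add_right_mono mult_left_mono) auto
    also have "\<dots> = D * y powr \<kappa>" by (simp add: D_def distrib_right)
    also have "\<dots> \<le> max 1 D * y powr \<kappa> * ln (3 + \<bar>Im s\<bar>) ^ (m - 1)"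
      using D l mult_mono[of "D * y powr \<kappa>" "max 1 D * y powr \<kappa>" 1 "ln (3 + \<bar>Im s\<bar>) ^ (m - 1)"]
      by (simp add: mult_right_mono)
    finally show "cmod (A s) \<le> max 1 D * (1 + \<bar>Im s\<bar>) powr \<kappa> * ln (3 + \<bar>Im s\<bar>) ^ (m - 1)"
      by (simp only: y_def)
  qed
  moreover have "\<exists>\<sigma>::real. \<forall>s. \<sigma> < Re s \<longrightarrow>
      (\<lambda>n. of_real (a (Suc n)) * of_real (l (Suc n)) powr (- s)) sums A s"
    using series unfolding A_def by blast
  ultimately have "hypothesis_B a l A \<alpha> \<delta> \<kappa> m"
    unfolding hypothesis_B_def using par a by simp
  then show ?thesis unfolding A_def[abs_def] .
qed

section \<open>Smoothness of the residue\<close>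

lemma of_real_powr_powr:
  assumes "0 < y"
  shows "complex_of_real (y powr t) powr s = complex_of_real y powr (of_real t * s)"
  using assms by (simp add: powr_def Ln_of_real mult_ac)

text \<open>After the pole is cleared, the residue is a Taylor coefficient of the numerator;
  \<open>0 \<notin> S\<close> keeps the factor \<open>1 / s\<close> holomorphic.\<close>

lemma residue_pole_plus_holomorphic:
  assumes "open S" "\<alpha> \<in> S" "H holomorphic_on S" "0 \<notin> S"
  shows "residue (\<lambda>s. (c / (s - \<alpha>) ^ Suc q + H s) * (w powr s / s)) \<alpha> =
    (deriv ^^ q) (\<lambda>s. (c + (s - \<alpha>) ^ Suc q * H s) / s * w powr s) \<alpha> / fact q"
proof -
  define f where "f s = (c + (s - \<alpha>) ^ Suc q * H s) / s * w powr s" for s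
  have "residue (\<lambda>s. (c / (s - \<alpha>) ^ Suc q + H s) * (w powr s / s)) \<alpha> =
      residue (\<lambda>s. f s / (s - \<alpha>) ^ Suc q) \<alpha>"
  proof (rule residue_cong[OF _ refl])
    have "(c / (s - \<alpha>) ^ Suc q + H s) * (w powr s / s) = f s / (s - \<alpha>) ^ Suc q" if "s \<noteq> \<alpha>" for s
    proof -
      have "(s - \<alpha>) ^ Suc q \<noteq> 0" using that by simp
      then have "c / (s - \<alpha>) ^ Suc q + H s = (c + (s - \<alpha>) ^ Suc q * H s) / (s - \<alpha>) ^ Suc q"
        by (simp only: add_divide_distrib nonzero_mult_div_cancel_left not_False_eq_True)
      then show ?thesis by (simp only: f_def times_divide_eq_left times_divide_eq_right divide_divide_eq_left mult.commute)
    qed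
    then show "\<forall>\<^sub>F s in at \<alpha>. (c / (s - \<alpha>) ^ Suc q + H s) * (w powr s / s) = f s / (s - \<alpha>) ^ Suc q"
      by (auto simp: eventually_at intro!: exI[of _ 1])
  qed
  also have "\<dots> = (deriv ^^ q) f \<alpha> / fact q"
    unfolding f_def using assms
    by (intro residue_holomorphic_over_power[of S] holomorphic_intros) auto
  finally show ?thesis by (simp only: f_def[abs_def])
qed

lemma higher_deriv_second_difference:
  assumes "f holomorphic_on S" "g holomorphic_on S" "h holomorphic_on S" "open S" "z \<in> S"
  shows "(deriv ^^ q) (\<lambda>s. f s - 2 * g s + h s) z = (deriv ^^ q) f z - 2 * (deriv ^^ q) g z + (deriv ^^ q) h z"
proof -
  have g2: "(\<lambda>s. 2 * g s) holomorphic_on S" by (intro holomorphic_intros assms)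
  have "(\<lambda>s. f s - 2 * g s) holomorphic_on S" by (intro holomorphic_intros assms)
  from higher_deriv_add[OF this assms(3-5)]
  show ?thesis
    using higher_deriv_diff[OF assms(1) g2 assms(4,5)] higher_deriv_cmult[OF assms(2,5,4)] by simp
qed

text \<open>The second difference in \<open>y\<close> commutes with the derivative in
  \<open>s\<close>. Cauchy's inequality on a small circle about \<open>\<alpha>\<close> reduces it
  to second differences of powers of \<open>y\<close>, and the radius costs the factor
  \<open>N powr e\<close> in place of logarithms.\<close>

lemma residue_second_difference_bound:
  fixes \<alpha> b e t :: real and c :: complex and q :: nat
  assumes "0 \<le> b" "b < \<alpha>" "H holomorphic_on {s. b < Re s}" "0 < e" "0 < t" "t * \<alpha> \<le> 1"
  defines "R \<equiv> \<lambda>y::real. residue (\<lambda>s. (c / (s - of_real \<alpha>) ^ Suc q + H s) *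
      (of_real (y powr t) powr s / s)) (of_real \<alpha>)"
  obtains C where "0 \<le> C" "\<And>N h. 1 \<le> N \<Longrightarrow> 0 \<le> h \<Longrightarrow>
     cmod (R N - 2 * R (N + h) + R (N + 2 * h)) \<le> C * h ^ 2 * N powr (t * \<alpha> + e - 2)"
proof -
  let ?S = "{s. b < Re s}" and ?\<alpha> = "complex_of_real \<alpha>"
  define g where "g s = (c + (s - ?\<alpha>) ^ Suc q * H s) / s" for s
  define f where "f y s = g s * of_real (y powr t) powr s" for y :: real and s
  \<comment> \<open>The three terms keep the disc inside the half-plane of \<open>H\<close>, make
    \<open>t * \<rho> \<le> e\<close>, and make \<open>t * \<rho> \<le> 1\<close>; the last gives
    \<open>Re w \<le> 2\<close>, as the second-order difference bound requires.\<close>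
  define \<rho> where "\<rho> = min ((\<alpha> - b) / 2) (min (e / t) (1 / t))"
  have S: "open ?S" by (rule open_halfspace_Re_gt)
  have \<alpha>S: "?\<alpha> \<in> ?S" using assms by simp
  have \<rho>: "0 < \<rho>" using assms by (simp add: \<rho>_def)
  have "\<rho> \<le> e / t" "\<rho> \<le> 1 / t" unfolding \<rho>_def by simp_all
  then have \<rho>t: "t * \<rho> \<le> e" "t * \<rho> \<le> 1" using assms by (simp_all add: field_simps)
  have sub: "cball ?\<alpha> \<rho> \<subseteq> ?S"
  proof
    fix s assume "s \<in> cball ?\<alpha> \<rho>"
    then have "\<alpha> - Re s \<le> \<rho>"
      using abs_Re_le_cmod[of "?\<alpha> - s"] by (simp add: dist_norm)
    moreover have "\<rho> \<le> (\<alpha> - b) / 2" unfolding \<rho>_def by (rule min.cobounded1)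
    ultimately show "s \<in> ?S" using assms by simp
  qed
  have hg: "g holomorphic_on ?S"
    unfolding g_def using assms by (intro holomorphic_intros) auto
  have hf: "f y holomorphic_on ?S" for y
    unfolding f_def using hg by (intro holomorphic_intros)
  have R: "R y = (deriv ^^ q) (f y) ?\<alpha> / fact q" for y
    unfolding R_def f_def g_def using assms(1)
    by (intro residue_pole_plus_holomorphic[OF S \<alpha>S assms(3)]) auto
  have "compact (g ` cball ?\<alpha> \<rho>)"
    by (rule compact_continuous_image[OF holomorphic_on_imp_continuous_on[OF holomorphic_on_subset[OF hg sub]]]) simp
  then obtain B where B: "0 < B" "\<And>s. s \<in> cball ?\<alpha> \<rho> \<Longrightarrow> cmod (g s) \<le> B"
    using compact_imp_bounded[of "g ` cball ?\<alpha> \<rho>"] by (auto simp: bounded_pos)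
  define C where "C = B * (t * (\<alpha> + \<rho>) + 2) ^ 2 / \<rho> ^ q"
  have "cmod (R N - 2 * R (N + h) + R (N + 2 * h)) \<le> C * h ^ 2 * N powr (t * \<alpha> + e - 2)"
    if N: "1 \<le> N" and h: "0 \<le> h" for N h
  proof -
    define F where "F s = f N s - 2 * f (N + h) s + f (N + 2 * h) s" for s
    define B' where "B' = B * (h ^ 2 * ((t * (\<alpha> + \<rho>) + 2) ^ 2 * N powr (t * \<alpha> + e - 2)))"
    have hF: "F holomorphic_on ?S" unfolding F_def by (intro holomorphic_intros hf)
    have "cmod (F s) \<le> B'" if s: "norm (?\<alpha> - s) = \<rho>" for s
    proof -
      define w where "w = of_real t * s"
      have cs: "s \<in> cball ?\<alpha> \<rho>" using s by (simp add: dist_norm)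
      have "Re s \<le> \<alpha> + \<rho>" using abs_Re_le_cmod[of "?\<alpha> - s"] s by simp
      then have "t * Re s \<le> t * (\<alpha> + \<rho>)" using assms by (intro mult_left_mono) auto
      then have w1: "Re w \<le> t * \<alpha> + e" "Re w \<le> 2"
        using \<rho>t assms(6) by (simp_all add: w_def distrib_left)
      have "cmod s \<le> \<alpha> + \<rho>" using norm_triangle_ineq2[of s ?\<alpha>] s assms by (simp add: norm_minus_commute)
      then have "t * cmod s \<le> t * (\<alpha> + \<rho>)" using assms by (intro mult_left_mono) auto
      then have w2: "cmod w \<le> t * (\<alpha> + \<rho>)" using assms by (simp add: w_def norm_mult)
      have "cmod (\<Sum>j\<le>2. (-1) ^ j * of_nat (2 choose j) * complex_of_real (N + real j * h) powr w)
         \<le> h ^ 2 * ((cmod w + real 2) ^ 2 * N powr (Re w - real 2))"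
        using N h w1 by (intro powr_finite_difference_bound) auto
      also have "(\<Sum>j\<le>2. (-1) ^ j * of_nat (2 choose j) * complex_of_real (N + real j * h) powr w)
        = complex_of_real N powr w - 2 * complex_of_real (N + h) powr w + complex_of_real (N + 2 * h) powr w"
        by (simp add: numeral_2_eq_2)
      also have "h ^ 2 * ((cmod w + real 2) ^ 2 * N powr (Re w - real 2))
        \<le> h ^ 2 * ((t * (\<alpha> + \<rho>) + 2) ^ 2 * N powr (t * \<alpha> + e - 2))"
        using w1 w2 N by (intro mult_left_mono mult_mono power_mono powr_mono) auto
      finally have 1: "cmod (complex_of_real N powr w - 2 * complex_of_real (N + h) powr w +
          complex_of_real (N + 2 * h) powr w) \<le> h ^ 2 * ((t * (\<alpha> + \<rho>) + 2) ^ 2 * N powr (t * \<alpha> + e - 2))" .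
      have "F s = g s * (complex_of_real N powr w - 2 * complex_of_real (N + h) powr w +
          complex_of_real (N + 2 * h) powr w)"
        using N h unfolding F_def f_def w_def by (simp add: of_real_powr_powr algebra_simps del: of_real_add of_real_mult)
      then show ?thesis
        unfolding B'_def using 1 B cs by (simp add: norm_mult mult_mono)
    qed
    then have "cmod ((deriv ^^ q) F ?\<alpha>) \<le> fact q * B' / \<rho> ^ q"
      by (rule Cauchy_inequality[OF holomorphic_on_subset[OF hF order_trans[OF ball_subset_cball sub]]
            holomorphic_on_imp_continuous_on[OF holomorphic_on_subset[OF hF sub]] \<rho>])
    moreover have "(deriv ^^ q) F ?\<alpha> = fact q * (R N - 2 * R (N + h) + R (N + 2 * h))"
      unfolding F_def higher_deriv_second_difference[OF hf hf hf S \<alpha>S] R by (simp add: field_simps)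
    ultimately have "fact q * cmod (R N - 2 * R (N + h) + R (N + 2 * h)) \<le> fact q * (B' / \<rho> ^ q)"
      by (simp add: norm_mult)
    then have "cmod (R N - 2 * R (N + h) + R (N + 2 * h)) \<le> B' / \<rho> ^ q"
      by (rule mult_left_le_imp_le) simp
    then show ?thesis by (simp add: B'_def C_def mult_ac)
  qed
  moreover have "0 \<le> C" using B \<rho> by (simp add: C_def)
  ultimately show thesis using that by blast
qed

section \<open>The second difference of the summatory function\<close>

text \<open>\<open>ln y / ln x \<le> exp (ln (y / x) / ln x)\<close> replaces the computation of a derivative.\<close>

lemma powr_times_ln_power_antimono:
  fixes x y p :: real
  assumes "1 < x" "real q \<le> p * ln x" "x \<le> y"
  shows "y powr (-p) * ln y ^ q \<le> x powr (-p) * ln x ^ q"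
proof -
  have lx: "0 < ln x" using assms by simp
  have y: "0 < y" using assms by simp
  have r: "1 \<le> y / x" using assms by simp
  have "ln y = ln x * (1 + ln (y / x) / ln x)"
    using lx y assms by (simp add: ln_div field_simps)
  also have "\<dots> \<le> ln x * exp (ln (y / x) / ln x)"
    using lx by (intro mult_left_mono) auto
  finally have "ln y ^ q \<le> (ln x * exp (ln (y / x) / ln x)) ^ q"
    using assms by (intro power_mono) auto
  also have "\<dots> = ln x ^ q * (y / x) powr (real q / ln x)"
    using y assms(1) by (simp add: power_mult_distrib exp_of_nat_mult[symmetric] powr_def)
  also have "\<dots> \<le> ln x ^ q * (y / x) powr p"
    using r lx assms by (intro mult_left_mono powr_mono) (auto simp: field_simps)
  finally have "y powr (-p) * ln y ^ q \<le> y powr (-p) * (ln x ^ q * (y / x) powr p)"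
    by (intro mult_left_mono) auto
  also have "\<dots> = x powr (-p) * ln x ^ q"
    using y assms by (simp add: powr_divide powr_minus divide_simps)
  finally show ?thesis .
qed

text \<open>The extra power carries the change of variable: \<open>z = p + t * s\<close> with
  \<open>p = 1 - t * \<alpha>\<close>, which is 7/8 for the chosen \<open>t\<close>.\<close>

definition weight :: "real \<Rightarrow> nat \<Rightarrow> nat \<Rightarrow> real \<Rightarrow> nat \<Rightarrow> real" where
  "weight \<theta> r q p n = real (Suc n) powr (-p) * (ln (real (Suc n)) ^ q + oscillation \<theta> r q n)"

lemma sum_second_difference:
  fixes w :: "nat \<Rightarrow> real"
  shows "(\<Sum>n<X. w n) - 2 * (\<Sum>n<X + h. w n) + (\<Sum>n<X + 2 * h. w n) = (\<Sum>i<h. w (X + h + i) - w (X + i))"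
proof -
  have s: "(\<Sum>n<M + h. w n) = (\<Sum>n<M. w n) + (\<Sum>i<h. w (M + i))" for M
  proof (induction h)
    case (Suc h)
    then show ?case by (simp add: add.assoc)
  qed simp
  have "(\<Sum>n<X + 2 * h. w n) = (\<Sum>n<X + h. w n) + (\<Sum>i<h. w (X + h + i))"
    using s[of "X + h"] by (simp add: mult_2 add.assoc)
  then show ?thesis using s[of X] by (simp add: sum_subtractf)
qed

text \<open>Terms of the first block are paired with those of the second. The logarithmic part
  decreases there, so it contributes with the right sign, and the oscillation passes from
  \<open>v\<close> to \<open>- real r * v\<close>; each of the \<open>h\<close> pairs gains at least
  \<open>Y powr (-p) / 2 * v\<close>.\<close>

lemma weight_second_difference:
  assumes "0 \<le> \<theta>" "0 < r" "0 \<le> p" "p \<le> 1" "1 \<le> k" "real q \<le> p * ln (2 ^ k)"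
    and big: "real r + 1 \<le> (2 ^ k) powr (1 - \<theta>)"
  defines "X \<equiv> 2 ^ k" and "h \<equiv> block_step \<theta> r k"
  shows "(2 ^ k) powr (1 - p - \<theta>) * ln (2 ^ k) ^ q / (2 ^ r * 4 * (real r + 1)) \<le>
    - ((\<Sum>n<X. weight \<theta> r q p n) - 2 * (\<Sum>n<X + h. weight \<theta> r q p n) + (\<Sum>n<X + 2 * h. weight \<theta> r q p n))"
proof -
  define v where "v = ln (2 ^ k :: real) ^ q / 2 ^ r"
  define Y where "Y = (2 ^ k :: real)"
  have v: "0 \<le> v" by (simp add: v_def)
  have Y: "2 \<le> Y" using power_increasing[of 1 k "2::real"] assms by (simp add: Y_def)
  have YX: "real X = Y" by (simp add: X_def Y_def)
  have hX: "(r + 1) * h \<le> X" using block_step_le(2)[of \<theta> r k] assms by simp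
  have "2 * h \<le> (r + 1) * h" using assms by (intro mult_right_mono) auto
  then have h2: "2 * h \<le> X" using hX by (rule order_trans)
  have step: "Y powr (-p) / 2 * v \<le> weight \<theta> r q p (X + i) - weight \<theta> r q p (X + h + i)" if i: "i < h" for i
  proof -
    define x where "x = Y + real i + 1"
    have h: "h \<noteq> 0" using i by simp
    have x: "Y \<le> x" "x \<le> 2 * Y" "1 < x"
    proof -
      have "real (X + i + 1) \<le> real (2 * X)" using i h2 by (simp only: of_nat_le_iff)
      then show "x \<le> 2 * Y" using YX by (simp add: x_def)
    qed (use Y in \<open>auto simp: x_def\<close>)
    have o1: "oscillation \<theta> r q (X + i) = v"
      using oscillation_block[of i k \<theta> r q] i h2 h by (simp add: X_def h_def v_def)
    have o2: "oscillation \<theta> r q (X + h + i) = - real r * v"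
      using oscillation_block[of "h + i" k \<theta> r q] i h2 h by (simp add: X_def h_def v_def add.assoc)
    have w1: "weight \<theta> r q p (X + i) = x powr (-p) * ln x ^ q + x powr (-p) * v"
      using o1 YX by (simp add: weight_def x_def distrib_left add_ac)
    have w2: "weight \<theta> r q p (X + h + i) = (x + real h) powr (-p) * ln (x + real h) ^ q
        - (x + real h) powr (-p) * (real r * v)"
      using o2 YX by (simp add: weight_def x_def distrib_left add_ac right_diff_distrib)
    have "ln Y \<le> ln x" using x Y by simp
    then have "p * ln Y \<le> p * ln x" using assms by (intro mult_left_mono) auto
    then have "(x + real h) powr (-p) * ln (x + real h) ^ q \<le> x powr (-p) * ln x ^ q"
      using x assms by (intro powr_times_ln_power_antimono) (auto simp: Y_def)
    moreover have "0 \<le> (x + real h) powr (-p) * (real r * v)" using v by simp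
    moreover have "Y powr (-p) / 2 * v \<le> x powr (-p) * v"
    proof (rule mult_right_mono[OF _ v])
      have "Y powr (-p) / 2 \<le> Y powr (-p) * 2 powr (-p)"
      proof -
        have "2 powr (-1) \<le> (2::real) powr (-p)" using assms by (intro powr_mono) auto
        then have "1 / 2 \<le> (2::real) powr (-p)" by (simp add: powr_minus)
        from mult_left_mono[OF this, of "Y powr (-p)"] show ?thesis by simp
      qed
      also have "\<dots> = (2 * Y) powr (-p)" by (simp add: powr_mult)
      also have "\<dots> \<le> x powr (-p)" using x assms by (intro powr_mono2') auto
      finally show "Y powr (-p) / 2 \<le> x powr (-p)" .
    qed
    ultimately show ?thesis using w1 w2 by linarith
  qed
  \<comment> \<open>By \<open>big\<close> the number under the floor is at least 1, so rounding down
    loses at most half of it.\<close>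
  have hl: "Y powr (1 - \<theta>) / (2 * (real r + 1)) \<le> real h"
  proof -
    define u where "u = Y powr (1 - \<theta>) / (real r + 1)"
    have "1 \<le> u" using big by (simp add: u_def Y_def)
    moreover have "real h = of_int \<lfloor>u\<rfloor>" using \<open>1 \<le> u\<close> by (simp add: h_def block_step_def u_def Y_def)
    moreover have "1 \<le> \<lfloor>u\<rfloor>" using \<open>1 \<le> u\<close> by simp
    then have "(1::real) \<le> of_int \<lfloor>u\<rfloor>" by simp
    moreover have "u < of_int \<lfloor>u\<rfloor> + 1" by simp
    ultimately have "u / 2 \<le> real h" by linarith
    then show ?thesis by (simp add: u_def mult.commute)
  qed
  have "Y powr (1 - p - \<theta>) * ln Y ^ q / (2 ^ r * 4 * (real r + 1))
      = Y powr (1 - \<theta>) / (2 * (real r + 1)) * (Y powr (-p) / 2 * v)"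
  proof -
    have "Y powr (1 - p - \<theta>) = Y powr (1 - \<theta>) * Y powr (-p)"
      unfolding powr_add[symmetric] by (simp add: algebra_simps)
    moreover have "a * b * w / (P * 4 * R) = a / (2 * R) * (b / 2 * (w / P))" for a b w P R :: real
      by (simp add: mult_ac)
    ultimately show ?thesis by (simp only: v_def Y_def)
  qed
  also have "\<dots> \<le> real h * (Y powr (-p) / 2 * v)"
    using hl v by (intro mult_right_mono) auto
  also have "\<dots> = (\<Sum>i<h. Y powr (-p) / 2 * v)" by simp
  also have "\<dots> \<le> (\<Sum>i<h. weight \<theta> r q p (X + i) - weight \<theta> r q p (X + h + i))"
    by (intro sum_mono step) auto
  also have "\<dots> = - (\<Sum>i<h. weight \<theta> r q p (X + h + i) - weight \<theta> r q p (X + i))"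
    by (simp add: sum_subtractf)
  finally show ?thesis unfolding sum_second_difference Y_def .
qed

section \<open>From second differences to the Omega estimate\<close>

lemma realpow_at_top:
  fixes x :: real
  shows "1 < x \<Longrightarrow> filterlim (\<lambda>k. x ^ k) at_top sequentially"
  by (intro filterlim_at_infinity_imp_filterlim_at_top filterlim_realpow_sequentially_gt1) auto

lemma dyadic_powr_at_top:
  assumes "0 < e"
  shows "filterlim (\<lambda>k. (2 ^ k :: real) powr e) at_top sequentially"
proof -
  have "(2::real) powr 0 < 2 powr e" using assms by (intro powr_less_mono) auto
  then have "filterlim (\<lambda>k. (2 powr e :: real) ^ k) at_top sequentially"
    by (intro realpow_at_top) simp
  moreover have "(2 powr e) ^ k = (2 ^ k :: real) powr e" for k
    by (simp add: powr_realpow[symmetric] powr_powr mult.commute)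
  ultimately show ?thesis by simp
qed

text \<open>Were the error \<open>o(g)\<close>, its values at \<open>X\<close>, \<open>X + h\<close>
  and \<open>X + 2h\<close> would be at most a small multiple of \<open>M\<close>, and the second
  difference of the residue is of smaller order still; together they contradict
  \<open>weight_second_difference\<close>.\<close>

lemma hl_omega_of_second_difference:
  fixes S :: "nat \<Rightarrow> real" and R :: "real \<Rightarrow> complex"
  assumes \<theta>: "0 < \<theta>" "\<theta> < 1/8" and r: "0 < r" and t: "0 < t" and c0: "0 < c0" and "\<beta> = 1/8 - \<theta>"
    and S: "\<And>N. S N = c0 * (\<Sum>n<N. weight \<theta> r q (7/8) n)"
    and f: "\<And>N. 1 \<le> N \<Longrightarrow> f (real N powr t) = of_real (S N) - R (real N)"
    and g: "\<And>N. 1 \<le> N \<Longrightarrow> g (real N powr t) = real N powr \<beta> * (t * ln (real N)) ^ q"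
    and C: "0 \<le> C" and R: "\<And>N h. 1 \<le> N \<Longrightarrow> 0 \<le> h \<Longrightarrow>
       cmod (R N - 2 * R (N + h) + R (N + 2 * h)) \<le> C * h ^ 2 * N powr (1/8 + \<theta>/2 - 2)"
  shows "hl_omega f g"
proof (rule ccontr)
  assume "\<not> hl_omega f g"
  then have L: "Limsup at_top (\<lambda>x. ereal (cmod (f x / of_real (g x)))) \<le> 0"
    by (simp add: hl_omega_def not_less)
  define c1 where "c1 = c0 / (2 ^ r * 4 * (real r + 1))"
  \<comment> \<open>\<open>D * M\<close> bounds \<open>g\<close> throughout \<open>[X, 2X]\<close>:
    a factor 2 comes from \<open>(2 * Y) powr \<beta>\<close>, and \<open>(2 * t) ^ q\<close> from
    \<open>ln N \<le> 2 * ln Y\<close>.\<close>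
  define D where "D = 2 * (2 * t) ^ q"
  \<comment> \<open>The weights 1, 2, 1 of the second difference add up to 4, so the three error
    terms amount to \<open>4 * \<eta> * D = c1 / 2\<close> times \<open>M\<close>.\<close>
  define \<eta> where "\<eta> = c1 / (8 * D)"
  have c1: "0 < c1" using c0 by (simp add: c1_def add_nonneg_pos)
  have D: "0 < D" using t by (simp add: D_def)
  have \<eta>: "0 < \<eta>" using c1 D by (simp add: \<eta>_def)
  have "Limsup at_top (\<lambda>x. ereal (cmod (f x / of_real (g x)))) < ereal \<eta>"
    using L \<eta> by (simp add: le_less_trans)
  from Limsup_lessD[OF this] obtain x0 where x0: "\<And>x. x0 \<le> x \<Longrightarrow> cmod (f x / of_real (g x)) < \<eta>"
    by (auto simp: eventually_at_top_linorder)
  \<comment> \<open>Four thresholds: blocks of positive length, points beyond \<open>x0\<close>, a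
    residue term below \<open>c1 / 2 * M\<close> (strictly, by the \<open>+ 1\<close>), and
    monotonicity of the logarithmic weights.\<close>
  have ev1: "\<forall>\<^sub>F k in sequentially. real r + 1 \<le> (2 ^ k) powr (1 - \<theta>)"
    using \<theta> by (intro filterlim_at_top[THEN iffD1, rule_format, OF dyadic_powr_at_top]) auto
  have ev2: "\<forall>\<^sub>F k in sequentially. max x0 1 \<le> (2 ^ k) powr t"
    using t by (intro filterlim_at_top[THEN iffD1, rule_format, OF dyadic_powr_at_top]) auto
  have ev3: "\<forall>\<^sub>F k in sequentially. 2 * C / c1 + 1 \<le> (2 ^ k) powr (\<theta> / 2)"
    using \<theta> by (intro filterlim_at_top[THEN iffD1, rule_format, OF dyadic_powr_at_top]) auto
  have ev4: "\<forall>\<^sub>F k in sequentially. real q \<le> 7/8 * ln (2 ^ k)"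
  proof -
    have "filterlim (\<lambda>k. ln ((2::real) ^ k)) at_top sequentially"
      by (rule filterlim_compose[OF ln_at_top realpow_at_top]) simp
    then have "\<forall>\<^sub>F k in sequentially. 8/7 * real q \<le> ln ((2::real) ^ k)"
      by (simp only: filterlim_at_top)
    then show ?thesis by eventually_elim simp
  qed
  have "\<forall>\<^sub>F k in sequentially. 2 \<le> k" by (rule eventually_ge_at_top)
  with ev1 ev2 ev3 ev4 have "\<forall>\<^sub>F k in sequentially. False"
  proof eventually_elim
    case (elim k)
    define X where "X = (2 ^ k :: nat)"
    define Y where "Y = (2 ^ k :: real)"
    define h where "h = block_step \<theta> r k"
    define M where "M = Y powr \<beta> * ln Y ^ q"
    have XY: "real X = Y" by (simp add: X_def Y_def)
    \<comment> \<open>\<open>Y \<ge> 4\<close> exceeds \<open>exp 1\<close>, giving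
      \<open>ln Y \<ge> 1\<close>, and makes \<open>2 * Y \<le> Y * Y\<close>.\<close>
    have Y: "4 \<le> Y" using power_increasing[OF elim(5), of "2::real"] by (simp add: Y_def)
    have X: "1 \<le> X" by (simp add: X_def)
    have "exp 1 \<le> Y" using exp_le Y by linarith
    then have lY: "1 \<le> ln Y" using Y ln_le_cancel_iff[of "exp 1" Y] by simp
    have hX: "(r + 1) * h \<le> X" using block_step_le(2)[of \<theta> r k] \<theta> by (simp add: h_def X_def)
    have "2 * h \<le> (r + 1) * h" using r by (intro mult_right_mono) auto
    then have h2: "2 * h \<le> X" using hX by (rule order_trans)
    have F: "cmod (f (real N powr t)) \<le> \<eta> * (D * M)" if N: "X \<le> N" "N \<le> 2 * X" for N
    proof -
      have N1: "1 \<le> N" using N X by simp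
      have NY: "Y \<le> real N" "real N \<le> 2 * Y" using N XY by (auto simp: of_nat_le_iff[symmetric, where ?'a = real] simp del: of_nat_le_iff)
      have "Y powr t \<le> real N powr t" using NY Y t by (intro powr_mono2) auto
      then have "x0 \<le> real N powr t" using elim(2) by (simp add: Y_def)
      from x0[OF this] have *: "cmod (f (real N powr t) / of_real (g (real N powr t))) < \<eta>" .
      have lN: "1 \<le> ln (real N)" using lY NY Y ln_le_cancel_iff[of Y "real N"] by linarith
      have gN: "g (real N powr t) = real N powr \<beta> * (t * ln (real N)) ^ q" by (rule g[OF N1])
      have gpos: "0 < g (real N powr t)" using gN lN t NY Y by simp
      have "real N powr \<beta> \<le> (2 * Y) powr \<beta>"
        using NY Y \<theta> assms(6) by (intro powr_mono2) auto
      also have "\<dots> = 2 powr \<beta> * Y powr \<beta>" by (simp add: powr_mult)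
      also have "\<dots> \<le> 2 powr 1 * Y powr \<beta>"
        using \<theta> assms(6) by (intro mult_right_mono powr_mono) auto
      finally have 1: "real N powr \<beta> \<le> 2 * Y powr \<beta>" by simp
      have "ln (real N) \<le> ln (2 * Y)" using NY Y by simp
      also have "\<dots> \<le> ln (Y * Y)" using Y by (subst ln_le_cancel_iff) auto
      also have "\<dots> = 2 * ln Y" using Y by (simp add: ln_mult)
      finally have "(t * ln (real N)) ^ q \<le> (t * (2 * ln Y)) ^ q"
        using t lN by (intro power_mono mult_left_mono) auto
      also have "\<dots> = (2 * t) ^ q * ln Y ^ q" by (simp add: power_mult_distrib)
      finally have "g (real N powr t) \<le> (2 * Y powr \<beta>) * ((2 * t) ^ q * ln Y ^ q)"
        unfolding gN using 1 t lN by (intro mult_mono) auto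
      also have "\<dots> = D * M" by (simp add: D_def M_def)
      finally have "\<eta> * g (real N powr t) \<le> \<eta> * (D * M)" using \<eta> by (intro mult_left_mono) auto
      moreover have "cmod (f (real N powr t)) \<le> \<eta> * g (real N powr t)"
        using * gpos by (simp add: norm_divide divide_simps)
      ultimately show ?thesis by simp
    qed
    have f0: "of_real (S X) = f (real X powr t) + R Y"
      using f[OF X] XY by simp
    have f1: "of_real (S (X + h)) = f (real (X + h) powr t) + R (Y + real h)"
      using f[of "X + h"] X XY by simp
    have f2: "of_real (S (X + 2 * h)) = f (real (X + 2 * h) powr t) + R (Y + 2 * real h)"
      using f[of "X + 2 * h"] X XY by simp
    define S2 where "S2 = S X - 2 * S (X + h) + S (X + 2 * h)"
    have "complex_of_real S2 = (f (real X powr t) - 2 * f (real (X + h) powr t) + f (real (X + 2 * h) powr t))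
        + (R Y - 2 * R (Y + real h) + R (Y + 2 * real h))"
      by (simp add: S2_def f0 f1 f2 del: of_nat_add of_nat_mult)
    then have "\<bar>S2\<bar> = cmod ((f (real X powr t) - 2 * f (real (X + h) powr t) + f (real (X + 2 * h) powr t))
        + (R Y - 2 * R (Y + real h) + R (Y + 2 * real h)))"
      by (metis norm_of_real)
    also have "\<dots> \<le> (cmod (f (real X powr t)) + 2 * cmod (f (real (X + h) powr t)) + cmod (f (real (X + 2 * h) powr t)))
        + cmod (R Y - 2 * R (Y + real h) + R (Y + 2 * real h))"
      by (rule order_trans[OF norm_triangle_ineq])
        (intro add_mono order_refl order_trans[OF norm_triangle_ineq] order_trans[OF norm_triangle_ineq4], simp add: norm_mult)
    also have "\<dots> \<le> (\<eta> * (D * M) + 2 * (\<eta> * (D * M)) + \<eta> * (D * M)) + C * real h ^ 2 * Y powr (1/8 + \<theta>/2 - 2)"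
      using h2 Y by (intro add_mono mult_left_mono F R) auto
    also have "\<dots> = c1 / 2 * M + C * (real h ^ 2 * Y powr (1/8 + \<theta>/2 - 2))"
      using D by (simp add: \<eta>_def field_simps)
    finally have up: "\<bar>S2\<bar> \<le> c1 / 2 * M + C * (real h ^ 2 * Y powr (1/8 + \<theta>/2 - 2))" .
    have "real h * 1 \<le> real h * (real r + 1)" by (intro mult_left_mono) auto
    also have "\<dots> \<le> Y powr (1 - \<theta>)"
      using block_step_le(1)[of \<theta> r k] \<theta> by (simp add: h_def Y_def)
    finally have "real h ^ 2 \<le> (Y powr (1 - \<theta>)) ^ 2" by (intro power_mono) auto
    then have "real h ^ 2 * Y powr (1/8 + \<theta>/2 - 2) \<le> (Y powr (1 - \<theta>)) ^ 2 * Y powr (1/8 + \<theta>/2 - 2)"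
      by (intro mult_right_mono) auto
    \<comment> \<open>\<open>2 * (1 - \<theta>) + 1/8 + \<theta>/2 - 2 = \<beta> -
      \<theta>/2\<close>: the residue falls short of the main size by
      \<open>Y powr (\<theta>/2)\<close>.\<close>
    also have "\<dots> = Y powr (\<beta> - \<theta>/2)"
      unfolding power2_eq_square powr_add[symmetric] by (simp add: assms(6))
    also have "\<dots> = Y powr \<beta> * 1 / Y powr (\<theta>/2)" by (simp add: powr_diff)
    also have "\<dots> \<le> M / Y powr (\<theta>/2)"
      unfolding M_def using lY by (intro divide_right_mono mult_left_mono one_le_power) auto
    finally have "C * (real h ^ 2 * Y powr (1/8 + \<theta>/2 - 2)) \<le> C * (M / Y powr (\<theta>/2))"
      using C by (intro mult_left_mono) auto
    moreover have "C * (M / Y powr (\<theta>/2)) < c1 / 2 * M"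
    proof -
      have M: "0 < M" using lY Y by (simp add: M_def)
      have "2 * C / c1 < Y powr (\<theta>/2)" using elim(3) by (simp add: Y_def)
      then have "C / Y powr (\<theta>/2) < c1 / 2" using c1 Y by (simp add: field_simps)
      from mult_strict_right_mono[OF this M] show ?thesis by simp
    qed
    ultimately have "\<bar>S2\<bar> < c1 * M" using up by linarith
    moreover have "c1 * M \<le> - S2"
    proof -
      have "Y powr (1 - 7/8 - \<theta>) * ln Y ^ q / (2 ^ r * 4 * (real r + 1)) \<le>
        - ((\<Sum>n<X. weight \<theta> r q (7/8) n) - 2 * (\<Sum>n<X + h. weight \<theta> r q (7/8) n) + (\<Sum>n<X + 2 * h. weight \<theta> r q (7/8) n))"
        unfolding X_def Y_def h_def using \<theta> r elim by (intro weight_second_difference) auto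
      from mult_left_mono[OF this, of c0] show ?thesis
        using c0 by (simp add: S2_def S c1_def M_def assms(6) algebra_simps)
    qed
    ultimately show False by linarith
  qed
  then show False by simp
qed

section \<open>Choice of parameters and assembly\<close>

theorem theoremB5:
  fixes \<alpha> \<delta> \<kappa> :: real and m :: nat
  assumes "\<alpha> > 0" and "0 < \<delta>" and "\<delta> < \<alpha>" and "\<kappa> > 1/2" and "m \<ge> 1"
  shows "\<exists>(l :: nat \<Rightarrow> real) (a :: nat \<Rightarrow> real) (A :: complex \<Rightarrow> complex).
    strict_mono_on {1..} l \<and> filterlim l at_top sequentially \<and> l 1 \<ge> 1 \<and>
    hypothesis_B a l A \<alpha> \<delta> \<kappa> m \<and>
    (\<forall>n\<ge>1. 0 \<le> a n \<and> a n \<le> 1) \<and>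
    hl_omega
      (\<lambda>x. of_real (general_dirichlet_partial_sum a l x)
            - residue (\<lambda>s. A s * (of_real x powr s / s)) (of_real \<alpha>))
      (\<lambda>x. x powr (\<alpha> - \<delta> / (\<kappa> + 1/2)) * ln x ^ (m - 1))"
proof -
  define q where "q = m - 1"
  have m: "m = Suc q" using assms by (simp add: q_def)
  define r where "r = nat \<lceil>\<kappa>\<rceil>"
  have r: "0 < r" "\<kappa> \<le> real r" using assms by (auto simp: r_def)
  \<comment> \<open>With \<open>t * \<alpha> = 1/8\<close> the line
    \<open>Re s = \<alpha> - \<delta>\<close> goes to \<open>Re z = 1 - t * \<delta> > 7/8\<close>,
    within reach of the zeta estimates.\<close>
  define t where "t = 1 / (8 * \<alpha>)"
  have t: "0 < t" "t * \<alpha> = 1/8" using assms by (auto simp: t_def)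
  \<comment> \<open>Chosen so that \<open>1 - \<theta> * (\<kappa> + 1/2)\<close> is the image of
    the critical line; at \<open>x = N powr t\<close> the claimed power of \<open>x\<close> becomes
    \<open>N powr (1/8 - \<theta>)\<close>.\<close>
  define \<theta> where "\<theta> = t * \<delta> / (\<kappa> + 1/2)"
  have \<theta>: "0 < \<theta>" using assms t by (simp add: \<theta>_def)
  have \<theta>\<kappa>: "\<theta> * (\<kappa> + 1/2) = t * \<delta>" using assms by (simp add: \<theta>_def)
  have t\<delta>: "t * \<delta> < 1/8" using mult_strict_left_mono[OF assms(3) t(1)] t(2) by simp
  have "\<theta> * 1 \<le> \<theta> * (\<kappa> + 1/2)" using \<theta> assms by (intro mult_left_mono) auto
  then have \<theta>8: "\<theta> < 1/8" using t\<delta> \<theta>\<kappa> by simp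
  let ?\<sigma> = "1 - \<theta> * (\<kappa> + 1/2) - \<theta> / 4"
  obtain G CG where G: "G holomorphic_on {z. ?\<sigma> < Re z}" "0 \<le> CG"
    "\<And>z. ?\<sigma> < Re z \<Longrightarrow> cmod (G z) \<le> CG * (cmod z + real r) powr \<kappa>"
    "\<And>z. 2 < Re z \<Longrightarrow> (\<lambda>n. complex_of_real (ln (real (Suc n)) ^ q + oscillation \<theta> r q n) *
        complex_of_real (real (Suc n)) powr (-z)) sums (fact q / (z - 1) ^ Suc q + G z)"
    using oscillating_dirichlet_series[of \<theta> r \<kappa> q] \<theta> r assms(4) \<theta>\<kappa> t\<delta> \<theta>8 by auto
  obtain B where B: "0 < B" "\<And>x::real. 1 \<le> x \<Longrightarrow> ln x ^ q \<le> B * x powr (7/8)"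
    using ln_power_le_powr[of "7/8" q] by auto
  \<comment> \<open>The weights are at most \<open>2 * B\<close>, so this scaling brings the
    coefficients into \<open>[0, 1]\<close>.\<close>
  define c0 where "c0 = 1 / (2 * B)"
  have c0: "0 < c0" using B by (simp add: c0_def)
  define a where "a n = c0 * weight \<theta> r q (7/8) (n - 1)" for n
  define l where "l n = real n powr t" for n
  \<comment> \<open>\<open>z - 1 = t * (s - \<alpha>)\<close> turns the pole of order
    \<open>m\<close> in \<open>z\<close> into one in \<open>s\<close> with the factor
    \<open>(1 / t) ^ m\<close>.\<close>
  define c where "c = complex_of_real (c0 * fact q * (1 / t) ^ m)"
  define H where "H s = of_real c0 * G (1 + (s - of_real \<alpha>) * of_real t)" for s
  define A where "A s = c / (s - of_real \<alpha>) ^ m + H s" for s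
  \<comment> \<open>The preimage of the abscissa \<open>?\<sigma>\<close> under the change of
    variable.\<close>
  define b where "b = \<alpha> - \<delta> - \<theta> / (4 * t)"
  have b: "b < \<alpha> - \<delta>" using \<theta> t by (simp add: b_def)
  have sig: "?\<sigma> < Re (1 + (s - of_real \<alpha>) * of_real t)" if "b < Re s" for s
  proof -
    have "b * t < Re s * t" using that t by (intro mult_strict_right_mono) auto
    moreover have "b * t = t * \<alpha> - t * \<delta> - \<theta> / 4" using t by (simp add: b_def algebra_simps)
    ultimately show ?thesis using \<theta>\<kappa> t(2) by (simp add: algebra_simps)
  qed
  have holH: "H holomorphic_on {s. b < Re s}"
  proof -
    have "(G \<circ> (\<lambda>s. 1 + (s - of_real \<alpha>) * of_real t)) holomorphic_on {s. b < Re s}"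
      using sig by (intro holomorphic_on_compose_gen[OF _ G(1)] holomorphic_intros) auto
    then show ?thesis unfolding H_def o_def by (intro holomorphic_on_mult holomorphic_on_const)
  qed
  have osc: "\<bar>oscillation \<theta> r q n\<bar> \<le> ln (real (Suc n)) ^ q" for n
    using \<theta> r by (intro abs_oscillation_le) auto
  have a01: "0 \<le> a n \<and> a n \<le> 1" for n
  proof -
    define x where "x = real (Suc (n - 1))"
    have x: "1 \<le> x" by (simp add: x_def)
    have o: "\<bar>oscillation \<theta> r q (n - 1)\<bar> \<le> ln x ^ q" using osc[of "n - 1"] by (simp only: x_def)
    have an: "a n = c0 * (x powr (-(7/8)) * (ln x ^ q + oscillation \<theta> r q (n - 1)))"
      by (simp only: a_def weight_def x_def)
    have "x powr (-(7/8)) * (ln x ^ q + oscillation \<theta> r q (n - 1)) \<le> x powr (-(7/8)) * (2 * (B * x powr (7/8)))"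
      using o B(2)[OF x] by (intro mult_left_mono) auto
    also have "\<dots> = 2 * B" using x by (simp add: powr_minus divide_simps)
    finally have "a n \<le> c0 * (2 * B)" unfolding an using c0 by (intro mult_left_mono) auto
    then have "a n \<le> 1" using B by (simp add: c0_def)
    moreover have "0 \<le> a n" unfolding an using c0 o by (intro mult_nonneg_nonneg) auto
    ultimately show ?thesis by simp
  qed
  \<comment> \<open>\<open>Re s > 9 * \<alpha>\<close> means
    \<open>t * (Re s - \<alpha>) > 1\<close>, that is \<open>Re z > 2\<close>.\<close>
  have series: "(\<lambda>n. of_real (a (Suc n)) * of_real (l (Suc n)) powr (- s)) sums
      (c / (s - of_real \<alpha>) ^ m + H s)" if s: "9 * \<alpha> < Re s" for s
  proof -
    define z where "z = 1 + (s - of_real \<alpha>) * of_real t"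
    have "9 * \<alpha> * t < Re s * t" using s t by (intro mult_strict_right_mono) auto
    then have "2 < Re z" using t(2) by (simp add: z_def algebra_simps)
    from sums_mult[OF G(4)[OF this], of "of_real c0"]
    have "(\<lambda>n. of_real c0 * (complex_of_real (ln (real (Suc n)) ^ q + oscillation \<theta> r q n) *
        complex_of_real (real (Suc n)) powr (-z))) sums (of_real c0 * (fact q / (z - 1) ^ Suc q + G z))" .
    moreover have "of_real c0 * (complex_of_real (ln (real (Suc n)) ^ q + oscillation \<theta> r q n) *
        complex_of_real (real (Suc n)) powr (-z)) = of_real (a (Suc n)) * of_real (l (Suc n)) powr (- s)" for n
    proof -
      have "complex_of_real (real (Suc n) powr (-(7/8))) = complex_of_real (real (Suc n)) powr (complex_of_real (-(7/8)))"
        by (rule powr_of_real[symmetric]) simp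
      moreover have "complex_of_real (l (Suc n)) powr (- s) = complex_of_real (real (Suc n)) powr (of_real t * (- s))"
        unfolding l_def by (rule of_real_powr_powr) simp
      moreover have "- z = complex_of_real (-(7/8)) + of_real t * (- s)"
      proof -
        have "complex_of_real t * of_real \<alpha> = of_real (1/8)" unfolding of_real_mult[symmetric] t(2) ..
        then show ?thesis by (simp add: z_def algebra_simps)
      qed
      ultimately show ?thesis
        by (simp only: a_def weight_def diff_Suc_1 of_real_mult powr_add mult_ac)
    qed
    moreover have "of_real c0 * (fact q / (z - 1) ^ Suc q + G z) = c / (s - of_real \<alpha>) ^ m + H s"
      using t by (simp add: z_def c_def H_def m power_mult_distrib distrib_left divide_simps)
    ultimately show ?thesis by simp
  qed
  have boundH: "cmod (H s) \<le> (c0 * CG * (2 + t + real r) powr \<kappa>) * (cmod s + 1) powr \<kappa>"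
    if s: "\<alpha> - \<delta> \<le> Re s" for s
  proof -
    define z where "z = 1 + (s - of_real \<alpha>) * of_real t"
    have "cmod z \<le> 1 + (cmod s + \<alpha>) * t"
    proof -
      have "cmod z \<le> 1 + cmod (s - of_real \<alpha>) * t"
        unfolding z_def using t by (intro order_trans[OF norm_triangle_ineq]) (simp add: norm_mult)
      also have "\<dots> \<le> 1 + (cmod s + \<alpha>) * t"
        using norm_triangle_ineq4[of s "of_real \<alpha>"] t assms by (intro add_left_mono mult_right_mono) auto
      finally show ?thesis .
    qed
    also have "\<dots> = 9/8 + cmod s * t" using t(2) by (simp add: algebra_simps)
    finally have "cmod z + real r \<le> 9/8 + cmod s * t + real r" by simp
    also have "\<dots> \<le> (2 + t + real r) * (cmod s + 1)"
    proof -
      have "0 \<le> real r * cmod s" by simp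
      moreover have "(2 + t + real r) * (cmod s + 1) = 2 + t + real r + 2 * cmod s + cmod s * t + real r * cmod s"
        by (simp add: algebra_simps)
      ultimately show ?thesis using t(1) norm_ge_zero[of s] by linarith
    qed
    finally have "(cmod z + real r) powr \<kappa> \<le> ((2 + t + real r) * (cmod s + 1)) powr \<kappa>"
      using assms by (intro powr_mono2) auto
    moreover have "cmod (G z) \<le> CG * (cmod z + real r) powr \<kappa>"
      using sig[of s] s b unfolding z_def by (intro G(3)) simp
    ultimately have "cmod (G z) \<le> CG * ((2 + t + real r) * (cmod s + 1)) powr \<kappa>"
      using G(2) by (meson mult_left_mono order_trans)
    then have "c0 * cmod (G z) \<le> c0 * (CG * ((2 + t + real r) powr \<kappa> * (cmod s + 1) powr \<kappa>))"
      using c0 by (simp add: powr_mult)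
    then show ?thesis using c0 by (simp add: H_def z_def norm_mult mult_ac)
  qed
  have hyp: "hypothesis_B a l A \<alpha> \<delta> \<kappa> m"
    unfolding A_def
  proof (rule hypothesis_B_pole_plus_holomorphic[OF assms(1-3) _ assms(5) _ series _ holH b _ boundH])
    show "c \<noteq> 0" using c0 t by (simp add: c_def)
    show "0 \<le> c0 * CG * (2 + t + real r) powr \<kappa>" using c0 G(2) by simp
  qed (use a01 assms in auto)
  have mono: "strict_mono_on {1..} l"
    unfolding l_def using t by (auto simp: strict_mono_on_def intro!: powr_less_mono2)
  have lim: "filterlim l at_top sequentially"
    unfolding l_def[abs_def] using t by real_asymp
  define R where "R y = residue (\<lambda>s. A s * (of_real (y powr t) powr s / s)) (of_real \<alpha>)" for y :: real
  obtain C where C: "0 \<le> C" "\<And>N h. 1 \<le> N \<Longrightarrow> 0 \<le> h \<Longrightarrow>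
       cmod (R N - 2 * R (N + h) + R (N + 2 * h)) \<le> C * h ^ 2 * N powr (t * \<alpha> + \<theta>/2 - 2)"
  \<comment> \<open>The abscissa \<open>\<alpha> - \<delta>\<close> is taken instead of
    \<open>b\<close>, which may be negative, so that \<open>1 / s\<close> is holomorphic in the
    half-plane.\<close>
  proof (rule residue_second_difference_bound[of "\<alpha> - \<delta>" \<alpha> H "\<theta>/2" t c q])
    show "H holomorphic_on {s. \<alpha> - \<delta> < Re s}"
      using holH by (rule holomorphic_on_subset) (use b in auto)
  qed (use assms \<theta> t in \<open>auto simp: R_def A_def m\<close>)
  have "hl_omega
      (\<lambda>x. of_real (general_dirichlet_partial_sum a l x)
            - residue (\<lambda>s. A s * (of_real x powr s / s)) (of_real \<alpha>))
      (\<lambda>x. x powr (\<alpha> - \<delta> / (\<kappa> + 1/2)) * ln x ^ (m - 1))"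
  proof (rule hl_omega_of_second_difference[OF \<theta> \<theta>8 r(1) t(1) c0 refl])
    fix N :: nat assume N: "1 \<le> N"
    \<comment> \<open>At \<open>x = l N\<close> the partial sum consists of exactly the first
      \<open>N\<close> coefficients; the shift by \<open>Suc\<close> matches the indexing of
      \<open>weight\<close>.\<close>
    have "{n. 1 \<le> n \<and> l n \<le> l N} = Suc ` {..<N}"
    proof -
      have "l n \<le> l N \<longleftrightarrow> n \<le> N" if "1 \<le> n" for n
        using strict_mono_on_less_eq[OF mono, of n N] that N by simp
      then have "{n. 1 \<le> n \<and> l n \<le> l N} = {1..N}" by auto
      also have "\<dots> = Suc ` {..<N}" by (simp add: lessThan_atLeast0 image_Suc_atLeastLessThan atLeastLessThanSuc_atLeastAtMost)
      finally show ?thesis .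
    qed
    then have "general_dirichlet_partial_sum a l (l N) = (\<Sum>n<N. a (Suc n))"
      unfolding general_dirichlet_partial_sum_def by (simp add: sum.reindex)
    also have "\<dots> = c0 * (\<Sum>n<N. weight \<theta> r q (7/8) n)"
      by (simp add: a_def sum_distrib_left)
    finally show "of_real (general_dirichlet_partial_sum a l (real N powr t)) -
        residue (\<lambda>s. A s * (of_real (real N powr t) powr s / s)) (of_real \<alpha>) =
        of_real (c0 * (\<Sum>n<N. weight \<theta> r q (7/8) n)) - R (real N)"
      by (simp only: R_def l_def)
    have "t * (\<alpha> - \<delta> / (\<kappa> + 1/2)) = 1/8 - \<theta>"
      using t(2) by (simp add: right_diff_distrib \<theta>_def)
    then show "(real N powr t) powr (\<alpha> - \<delta> / (\<kappa> + 1/2)) * ln (real N powr t) ^ (m - 1) =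
        real N powr (1/8 - \<theta>) * (t * ln (real N)) ^ q"
      using N by (simp add: powr_powr q_def ln_powr)
  qed (use C t(2) in auto)
  moreover have "1 \<le> l 1" by (simp add: l_def)
  ultimately show ?thesis using mono lim hyp a01 by blast
qed

end
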